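(* Let $p$ be an odd prime and let $G$ be an $\mathcal{M}_1$ $p$-group. Then $\mho_i(G)=\{g^{p^i}\mid g\in G\}$ for all integers $i\geq 1$.
   Context: For a finite $p$-group $G$ and $k\ge 0$, $\mho_k(G)=\langle g^{p^k} \mid g\in G\rangle$. For $p$ odd, a finite $p$-group $G$ is powerful if $[G,G]\leq \mho_1(G)$. An $\mathcal{M}_1$ $p$-group is a finite $p$-group all of whose maximal subgroups (i.e. subgroups of index $p$) are powerful. *)

theory Defs
  imports "HOL-Algebra.Algebra" "HOL-Computational_Algebra.Primes"
begin

definition finite_p_group :: "nat \<Rightarrow> ('a, 'b) monoid_scheme \<Rightarrow> bool" where
  "finite_p_group p G \<longleftrightarrow> Factorial_Ring.prime p \<and> group G \<and> finite (carrier G) \<and> (\<exists>n. order G = p ^ n)"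

definition agemo :: "nat \<Rightarrow> nat \<Rightarrow> ('a, 'b) monoid_scheme \<Rightarrow> 'a set" where
  "agemo p k G = generate G {g [^]\<^bsub>G\<^esub> (p ^ k) | g. g \<in> carrier G}"

(* The notion of powerful for odd p only; for p = 2 the usual condition involves 4-th powers. *)
definition powerful :: "nat \<Rightarrow> ('a, 'b) monoid_scheme \<Rightarrow> bool" where
  "powerful p G \<longleftrightarrow> finite_p_group p G \<and> derived G (carrier G) \<subseteq> agemo p 1 G"

(* In a finite p-group these are exactly the subgroups of index p. *)
definition maximal_subgroup :: "'a set \<Rightarrow> ('a, 'b) monoid_scheme \<Rightarrow> bool" where
  "maximal_subgroup M G \<longleftrightarrow> subgroup M G \<and> M \<noteq> carrier G \<and>
     (\<forall>K. subgroup K G \<longrightarrow> M \<subseteq> K \<longrightarrow> K = M \<or> K = carrier G)"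

definition M1_p_group :: "nat \<Rightarrow> ('a, 'b) monoid_scheme \<Rightarrow> bool" where
  "M1_p_group p G \<longleftrightarrow> finite_p_group p G \<and>
     (\<forall>M. maximal_subgroup M G \<longrightarrow> powerful p (G\<lparr>carrier := M\<rparr>))"

end

theory Submission
  imports Defs
begin

text \<open>
  Write \<open>G\<^sup>p\<close> for the subgroup generated by the \<open>p\<close>-th powers of \<open>G\<close>. It has to be shown that a
  product of two \<open>p\<^sup>i\<close>-th powers is again a \<open>p\<^sup>i\<close>-th power.

  For a powerful group \<open>M\<close> with \<open>p\<close> odd this is classical. The series \<open>M, M\<^sup>p, (M\<^sup>p)\<^sup>p, \<dots>\<close> is normal, and
  commutation with \<open>M\<close> moves each term into the next one (\<open>commutator_power_span_step\<close>). Hence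
  \<open>(xz)\<^sup>p = x\<^sup>p z\<^sup>p\<close> up to an error two steps further down than \<open>z\<close>, and successive approximation turns
  every element of \<open>M\<^sup>p\<close> into a \<open>p\<close>-th power (\<open>power_span_eq_powers\<close>). As \<open>M\<^sup>p\<close> is powerful too, higher
  powers follow by iteration (\<open>powerful_pow_mult_closed\<close>).

  Now let all maximal subgroups of \<open>G\<close> be powerful, and let \<open>G\<close> itself not be powerful. Then \<open>G\<close> is not
  abelian, so no element generates it and every element lies in a maximal subgroup.
  If \<open>x\<close> lies in the maximal subgroup \<open>M\<close>, then \<open>x\<^sup>p\<close> lies in \<open>M\<^sup>p\<close> and \<open>y\<^sup>p\<close> lies in \<open>M\<close>, so that
  \<open>[x\<^sup>p, y\<^sup>p]\<close> lies in \<open>(M\<^sup>p)\<^sup>p\<close>. This makes \<open>G\<^sup>p\<close> powerful (\<open>power_span_powerful\<close>), and everything is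
  reduced to the case \<open>i = 1\<close>.

  For \<open>i = 1\<close> let \<open>x\<close> and \<open>y\<close> have no common maximal subgroup; choose maximal subgroups \<open>M\<close> containing
  \<open>x\<close> and \<open>N\<close> containing \<open>y\<close>, and put \<open>F = M \<inter> N\<close>, \<open>K = F\<^sup>p\<close>. There is a third maximal subgroup \<open>R\<close>, generated
  by \<open>xy\<close> and \<open>F\<close>. Modulo \<open>K\<close> each of \<open>M\<^sup>p, N\<^sup>p, R\<^sup>p\<close> is central and cyclic of order at most \<open>p\<close>, generated
  by \<open>x\<^sup>p\<close>, \<open>y\<^sup>p\<close> and \<open>(xy)\<^sup>p\<close> respectively (\<open>maximal_cyclic_extension\<close>). With \<open>c = [y, x]\<close>, the
  commutators \<open>u = [c, x]\<close> and \<open>v = [c, y]\<close> lie in \<open>M\<^sup>p\<close> and \<open>N\<^sup>p\<close>, so \<open>\<langle>x, y\<rangle>\<close> has class at most 3 modulo \<open>K\<close>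
  and the collection formula expands \<open>(xy)\<^sup>p\<close> as \<open>x\<^sup>p y\<^sup>p\<close> times powers of \<open>u\<close> and \<open>v\<close> with exponents
  divisible by the binomial coefficient \<open>p choose 3\<close>.
  For \<open>p > 3\<close> these powers vanish modulo \<open>K\<close>, so \<open>x\<^sup>p y\<^sup>p\<close> lies in \<open>R\<^sup>p\<close>, which consists of \<open>p\<close>-th powers.
  For \<open>p = 3\<close> the subgroup \<open>R\<^sup>p\<close> contains \<open>x\<^sup>3 y\<^sup>3 u v\<^sup>2\<close> and also \<open>uv\<close> modulo \<open>K\<close>, where \<open>u\<close> and \<open>v\<close> are powers
  of \<open>x\<^sup>3\<close> and \<open>y\<^sup>3\<close>; linear algebra over the field of three elements places \<open>x\<^sup>3 y\<^sup>3\<close> in \<open>R\<^sup>p\<close> or in \<open>M\<^sup>p\<close>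
  (\<open>exponent_three_mem_or_eq\<close>, \<open>p_pow_mult_closed\<close>).
\<close>

text \<open>
This is the convention for which \<open>xy = yx[x, y]\<close>, which suits collecting to the right; the set of
commutators of a subgroup is the same as for the convention \<open>xyx\<^sup>-\<^sup>1y\<^sup>-\<^sup>1\<close>.
\<close>

definition commutator :: "('a, 'b) monoid_scheme \<Rightarrow> 'a \<Rightarrow> 'a \<Rightarrow> 'a" where
  "commutator G x y = inv\<^bsub>G\<^esub> x \<otimes>\<^bsub>G\<^esub> inv\<^bsub>G\<^esub> y \<otimes>\<^bsub>G\<^esub> x \<otimes>\<^bsub>G\<^esub> y"

definition power_span :: "('a, 'b) monoid_scheme \<Rightarrow> nat \<Rightarrow> 'a set \<Rightarrow> 'a set" where
  "power_span G n S = generate G ((\<lambda>x. x [^]\<^bsub>G\<^esub> n) ` S)"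

section \<open>Power formulas\<close>

context group
begin

lemma commute_mult_right:
  assumes "a \<otimes> b = b \<otimes> a" "a \<otimes> c = c \<otimes> a" "a \<in> carrier G" "b \<in> carrier G" "c \<in> carrier G"
  shows "a \<otimes> (b \<otimes> c) = (b \<otimes> c) \<otimes> a"
  using assms by (metis m_assoc)

lemma commute_pow:
  assumes "a \<otimes> b = b \<otimes> a" "a \<in> carrier G" "b \<in> carrier G"
  shows "a \<otimes> b [^] (n::nat) = b [^] n \<otimes> a"
  using group_commutes_pow[of b a n] assms by simp

lemma pow_swap_central:
  assumes carr: "c \<in> carrier G" "y \<in> carrier G" "v \<in> carrier G"
    and cy: "c \<otimes> y = y \<otimes> c \<otimes> v" and vy: "v \<otimes> y = y \<otimes> v" and vc: "v \<otimes> c = c \<otimes> v"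
  shows "c [^] (n::nat) \<otimes> y = y \<otimes> c [^] n \<otimes> v [^] n"
    and "c \<otimes> y [^] (n::nat) = y [^] n \<otimes> c \<otimes> v [^] n"
proof -
  note [simp] = carr
  show "c [^] n \<otimes> y = y \<otimes> c [^] n \<otimes> v [^] n"
  proof (induction n)
    case (Suc n)
    have "c [^] Suc n \<otimes> y = c [^] n \<otimes> (c \<otimes> y)" by (simp add: m_assoc)
    also have "\<dots> = (c [^] n \<otimes> y) \<otimes> (c \<otimes> v)" by (simp add: cy m_assoc)
    also have "\<dots> = y \<otimes> c [^] n \<otimes> (v [^] n \<otimes> c) \<otimes> v" by (simp add: Suc m_assoc)
    also have "v [^] n \<otimes> c = c \<otimes> v [^] n" using commute_pow[of c v n] vc by simp
    finally show ?case by (simp add: m_assoc)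
  qed simp
  show "c \<otimes> y [^] n = y [^] n \<otimes> c \<otimes> v [^] n"
  proof (induction n)
    case (Suc n)
    have "c \<otimes> y [^] Suc n = y [^] n \<otimes> c \<otimes> (v [^] n \<otimes> y)" by (simp add: Suc flip: m_assoc)
    also have "v [^] n \<otimes> y = y \<otimes> v [^] n" using commute_pow[of y v n] vy by simp
    also have "y [^] n \<otimes> c \<otimes> (y \<otimes> v [^] n) = y [^] n \<otimes> (c \<otimes> y) \<otimes> v [^] n" by (simp add: m_assoc)
    also have "\<dots> = y [^] Suc n \<otimes> c \<otimes> (v \<otimes> v [^] n)" by (simp add: cy m_assoc)
    also have "v \<otimes> v [^] n = v [^] Suc n" using nat_pow_Suc2[of v n] by simp
    finally show ?case .
  qed simp
qed

text \<open>
Moving \<open>x\<close> to the left past each of the \<open>n\<close> letters \<open>y\<close> produces one \<open>c\<close> per letter, and each \<open>c\<close> must then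
pass the letters \<open>y\<close> to its right: one \<open>v\<close> for each pair of letters.
\<close>

lemma pow_swap:
  assumes carr: "x \<in> carrier G" "y \<in> carrier G" "c \<in> carrier G" "v \<in> carrier G"
    and yx: "y \<otimes> x = x \<otimes> y \<otimes> c" and cy: "c \<otimes> y = y \<otimes> c \<otimes> v"
    and vy: "v \<otimes> y = y \<otimes> v" and vc: "v \<otimes> c = c \<otimes> v"
  shows "y [^] n \<otimes> x = x \<otimes> y [^] n \<otimes> c [^] n \<otimes> v [^] (n choose 2)"
proof (induction n)
  case (Suc n)
  note [simp] = carr
  have "y [^] Suc n \<otimes> x = y \<otimes> (y [^] n \<otimes> x)" using nat_pow_Suc2[of y n] by (simp add: m_assoc)
  also have "\<dots> = (y \<otimes> x) \<otimes> y [^] n \<otimes> c [^] n \<otimes> v [^] (n choose 2)" by (simp add: Suc m_assoc)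
  also have "\<dots> = x \<otimes> y \<otimes> (c \<otimes> y [^] n) \<otimes> c [^] n \<otimes> v [^] (n choose 2)" by (simp add: yx m_assoc)
  also have "\<dots> = x \<otimes> (y \<otimes> y [^] n) \<otimes> c \<otimes> (v [^] n \<otimes> c [^] n) \<otimes> v [^] (n choose 2)"
    by (simp add: pow_swap_central[OF carr(3,2,4) cy vy vc] m_assoc)
  also have "v [^] n \<otimes> c [^] n = c [^] n \<otimes> v [^] n"
    using commute_pow[of "v [^] n" c n] commute_pow[of c v n] vc by simp
  also have "x \<otimes> (y \<otimes> y [^] n) \<otimes> c \<otimes> (c [^] n \<otimes> v [^] n) \<otimes> v [^] (n choose 2)
      = x \<otimes> (y \<otimes> y [^] n) \<otimes> (c \<otimes> c [^] n) \<otimes> (v [^] n \<otimes> v [^] (n choose 2))"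
    by (simp add: m_assoc)
  also have "\<dots> = x \<otimes> y [^] Suc n \<otimes> c [^] Suc n \<otimes> v [^] (Suc n choose 2)"
    using nat_pow_Suc2[of y n] nat_pow_Suc2[of c n] by (simp add: nat_pow_mult numeral_2_eq_2)
  finally show ?case .
qed (use carr in \<open>simp add: numeral_2_eq_2\<close>)

text \<open>
Hall's collection formula in class 3, by induction on \<open>n\<close>: the new \<open>x\<close> passes \<open>y\<^sup>n\<close> and the collected
powers of \<open>c\<close>, then the new \<open>y\<close> passes the powers of \<open>c\<close>, and the exponents follow Pascal's rule.
\<close>

lemma pow_mult_class3:
  assumes carr: "x \<in> carrier G" "y \<in> carrier G" "c \<in> carrier G" "u \<in> carrier G" "v \<in> carrier G"
    and yx: "y \<otimes> x = x \<otimes> y \<otimes> c" and cx: "c \<otimes> x = x \<otimes> c \<otimes> u" and cy: "c \<otimes> y = y \<otimes> c \<otimes> v"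
    and u: "\<And>g. g \<in> carrier G \<Longrightarrow> u \<otimes> g = g \<otimes> u"
    and v: "\<And>g. g \<in> carrier G \<Longrightarrow> v \<otimes> g = g \<otimes> v"
  shows "(x \<otimes> y) [^] n = x [^] n \<otimes> y [^] n \<otimes> c [^] (n choose 2)
           \<otimes> u [^] (n choose 3) \<otimes> v [^] ((n choose 2) + 2 * (n choose 3))"
proof (induction n)
  case (Suc n)
  note [simp] = carr
  define k i j where "k = n choose 2" and "i = n choose 3" and "j = (n choose 2) + 2 * (n choose 3)"
  have ku: "u [^] m \<otimes> g = g \<otimes> u [^] m" if "g \<in> carrier G" for g and m :: nat
    using commute_pow[of g u m] u that by simp
  have kv: "v [^] m \<otimes> g = g \<otimes> v [^] m" if "g \<in> carrier G" for g and m :: nat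
    using commute_pow[of g v m] v that by simp
  have vc: "v \<otimes> c = c \<otimes> v" and uc: "u \<otimes> c = c \<otimes> u" and vy: "v \<otimes> y = y \<otimes> v" and ux: "u \<otimes> x = x \<otimes> u"
    by (simp_all add: u v)
  have "(x \<otimes> y) [^] Suc n = x [^] n \<otimes> y [^] n \<otimes> c [^] k \<otimes> u [^] i \<otimes> v [^] j \<otimes> (x \<otimes> y)"
    by (simp add: Suc k_def i_def j_def)
  also have "\<dots> = x [^] n \<otimes> y [^] n \<otimes> c [^] k \<otimes> u [^] i \<otimes> (v [^] j \<otimes> (x \<otimes> y))"
    by (simp add: m_assoc)
  also have "\<dots> = x [^] n \<otimes> y [^] n \<otimes> c [^] k \<otimes> (u [^] i \<otimes> (x \<otimes> y)) \<otimes> v [^] j"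
    by (simp add: kv[of "x \<otimes> y"] m_assoc)
  also have "\<dots> = x [^] n \<otimes> y [^] n \<otimes> (c [^] k \<otimes> x) \<otimes> y \<otimes> u [^] i \<otimes> v [^] j"
    by (simp add: ku[of "x \<otimes> y"] m_assoc)
  also have "\<dots> = x [^] n \<otimes> (y [^] n \<otimes> x) \<otimes> c [^] k \<otimes> (u [^] k \<otimes> y) \<otimes> u [^] i \<otimes> v [^] j"
    by (simp add: pow_swap_central(1)[OF carr(3,1,4) cx ux uc] m_assoc)
  also have "\<dots> = x [^] n \<otimes> (y [^] n \<otimes> x) \<otimes> (c [^] k \<otimes> y) \<otimes> u [^] (k + i) \<otimes> v [^] j"
    by (simp add: ku[of y] m_assoc flip: nat_pow_mult)
  also have "\<dots> = x [^] n \<otimes> x \<otimes> y [^] n \<otimes> c [^] n \<otimes> (v [^] k \<otimes> (c [^] k \<otimes> y)) \<otimes> u [^] (k + i) \<otimes> v [^] j"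
    by (simp add: pow_swap[OF carr(1,2,3,5) yx cy vy vc] k_def m_assoc)
  also have "\<dots> = x [^] Suc n \<otimes> y [^] n \<otimes> (c [^] n \<otimes> c [^] k \<otimes> y) \<otimes> (v [^] k \<otimes> u [^] (k + i)) \<otimes> v [^] j"
    by (simp add: kv[of "c [^] k \<otimes> y"] m_assoc)
  also have "c [^] n \<otimes> c [^] k \<otimes> y = y \<otimes> c [^] (n + k) \<otimes> v [^] (n + k)"
    by (simp add: nat_pow_mult pow_swap_central(1)[OF carr(3,2,5) cy vy vc])
  also have "x [^] Suc n \<otimes> y [^] n \<otimes> (y \<otimes> c [^] (n + k) \<otimes> v [^] (n + k)) \<otimes> (v [^] k \<otimes> u [^] (k + i)) \<otimes> v [^] j
     = x [^] Suc n \<otimes> y [^] Suc n \<otimes> c [^] (n + k) \<otimes> ((v [^] (n + k) \<otimes> v [^] k) \<otimes> u [^] (k + i)) \<otimes> v [^] j"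
    by (simp add: m_assoc)
  also have "\<dots> = x [^] Suc n \<otimes> y [^] Suc n \<otimes> c [^] (n + k) \<otimes> u [^] (k + i) \<otimes> v [^] (n + k + k + j)"
    by (simp add: nat_pow_mult kv[of "u [^] (k + i)"]) (simp add: m_assoc nat_pow_mult)
  also have "n + k = Suc n choose 2" by (simp add: k_def numeral_2_eq_2)
  also have "k + i = Suc n choose 3" by (simp add: k_def i_def numeral_2_eq_2 numeral_3_eq_3)
  also have "(Suc n choose 2) + k + j = (Suc n choose 2) + 2 * (Suc n choose 3)"
    by (simp add: k_def j_def numeral_2_eq_2 numeral_3_eq_3)
  finally show ?case .
qed (use carr in \<open>simp add: numeral_2_eq_2 numeral_3_eq_3\<close>)

end

section \<open>Central elements of quotients of p-groups\<close>

lemma finite_p_group_subgroup: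
  assumes "finite_p_group p G" "subgroup H G"
  shows "finite_p_group p (G\<lparr>carrier := H\<rparr>)"
proof -
  from assms(1) interpret group G by (simp add: finite_p_group_def)
  from assms(1) obtain n where n: "order G = p ^ n" and p: "Factorial_Ring.prime p" and fin: "finite (carrier G)"
    by (auto simp: finite_p_group_def)
  have "card H dvd p ^ n" using lagrange[OF assms(2)] n by (metis dvd_triv_right)
  then obtain m where "card H = p ^ m" using divides_primepow_nat[OF p] by auto
  moreover have "finite H" using fin subgroup.subset[OF assms(2)] finite_subset by blast
  ultimately show ?thesis
    using p subgroup_imp_group[OF assms(2)] by (auto simp: finite_p_group_def order_def)
qed

lemma finite_p_group_quotient:
  assumes "finite_p_group p G" "K \<lhd> G"
  shows "finite_p_group p (G Mod K)"
proof -
  from assms(1) interpret group G by (simp add: finite_p_group_def)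
  interpret K: normal K G by (fact assms(2))
  from assms(1) obtain n where n: "order G = p ^ n" and p: "Factorial_Ring.prime p" and fin: "finite (carrier G)"
    by (auto simp: finite_p_group_def)
  have "card (rcosets\<^bsub>G\<^esub> K) dvd p ^ n" using lagrange[OF K.is_subgroup] n by (metis dvd_triv_left)
  then obtain m where "card (rcosets\<^bsub>G\<^esub> K) = p ^ m" using divides_primepow_nat[OF p] by auto
  moreover have "finite (rcosets\<^bsub>G\<^esub> K)" using fin by (simp add: RCOSETS_def)
  ultimately show ?thesis
    using p K.factorgroup_is_group by (auto simp: finite_p_group_def order_def FactGroup_def)
qed

text \<open>
Conjugation splits \<open>N - {1}\<close> into orbits of \<open>p\<close>-power length. If none of them had length 1, then \<open>p\<close> would
divide both \<open>card N - 1\<close> and \<open>card N\<close>.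
\<close>

lemma p_group_normal_meets_center:
  assumes G: "finite_p_group p G" and N: "N \<lhd> G" and nontriv: "N \<noteq> {\<one>\<^bsub>G\<^esub>}"
  obtains z where "z \<in> N" "z \<noteq> \<one>\<^bsub>G\<^esub>" "\<And>g. g \<in> carrier G \<Longrightarrow> z \<otimes>\<^bsub>G\<^esub> g = g \<otimes>\<^bsub>G\<^esub> z"
proof -
  interpret N: normal N G by (fact N)
  from G obtain n where n: "order G = p ^ n" and p: "Factorial_Ring.prime p" and fin: "finite (carrier G)"
    by (auto simp: finite_p_group_def)
  define \<phi> where "\<phi> = (\<lambda>g. \<lambda>h \<in> carrier G. g \<otimes>\<^bsub>G\<^esub> h \<otimes>\<^bsub>G\<^esub> inv\<^bsub>G\<^esub> g)"
  interpret act: group_action G "carrier G" \<phi>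
    unfolding \<phi>_def by (rule N.action_by_conjugation)
  have \<phi>_in: "\<phi> g h \<in> N" if "g \<in> carrier G" "h \<in> N" for g h
    using that N.subset N.inv_op_closed2 by (auto simp: \<phi>_def)
  have finN: "finite N" using fin N.subset finite_subset by blast
  have "\<exists>z\<in>N. z \<noteq> \<one>\<^bsub>G\<^esub> \<and> (\<forall>g\<in>carrier G. \<phi> g z = z)"
  proof (rule ccontr)
    assume neg: "\<not> ?thesis"
    define C where "C = orbit G \<phi> ` (N - {\<one>\<^bsub>G\<^esub>})"
    have self: "z \<in> orbit G \<phi> z" if "z \<in> N" for z using act.orbit_refl that N.subset by auto
    have one: "w \<noteq> \<one>\<^bsub>G\<^esub>" if "z \<in> N" "z \<noteq> \<one>\<^bsub>G\<^esub>" "w \<in> orbit G \<phi> z" for z w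
    proof
      assume "w = \<one>\<^bsub>G\<^esub>"
      then have "z \<in> orbit G \<phi> \<one>\<^bsub>G\<^esub>" using that act.orbit_sym[of z w] N.subset by auto
      then show False using that by (auto simp: orbit_def \<phi>_def)
    qed
    have U: "\<Union>C = N - {\<one>\<^bsub>G\<^esub>}"
    proof
      show "\<Union>C \<subseteq> N - {\<one>\<^bsub>G\<^esub>}" using one by (auto simp: C_def orbit_def \<phi>_in)
      show "N - {\<one>\<^bsub>G\<^esub>} \<subseteq> \<Union>C" using self by (auto simp: C_def)
    qed
    have "p dvd card (\<Union>C)"
    proof (rule dvd_partition)
      show "finite (\<Union>C)" using U finN by simp
      show "\<forall>c1\<in>C. \<forall>c2\<in>C. c1 \<noteq> c2 \<longrightarrow> c1 \<inter> c2 = {}"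
      proof (intro ballI impI)
        fix c1 c2 assume "c1 \<in> C" "c2 \<in> C" "c1 \<noteq> c2"
        moreover have "C \<subseteq> orbits G (carrier G) \<phi>" using N.subset by (auto simp: C_def orbits_def)
        ultimately show "c1 \<inter> c2 = {}" using act.disjoint_union[of c1 c2] by auto
      qed
      show "\<forall>c\<in>C. p dvd card c"
      proof
        fix c assume "c \<in> C"
        then obtain z where z: "z \<in> N" "z \<noteq> \<one>\<^bsub>G\<^esub>" and c: "c = orbit G \<phi> z" by (auto simp: C_def)
        have zc: "z \<in> carrier G" using z N.subset by auto
        have "card c dvd p ^ n" using act.orbit_stabilizer_theorem[OF zc] n c by (metis dvd_triv_left)
        then obtain m where m: "card c = p ^ m" using divides_primepow_nat[OF p] by auto
        obtain g where g: "g \<in> carrier G" "\<phi> g z \<noteq> z" using neg z by auto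
        have "finite c" using U finN \<open>c \<in> C\<close> by (metis Union_upper finite_Diff finite_subset)
        moreover have "{z, \<phi> g z} \<subseteq> c" using c self z g by (auto simp: orbit_def)
        ultimately have "card {z, \<phi> g z} \<le> card c" by (rule card_mono)
        then have "m \<noteq> 0" using g m by (auto intro: Nat.gr0I)
        then show "p dvd card c" using m by simp
      qed
    qed
    then have 1: "p dvd card N - 1" using U finN by simp
    have "card N dvd p ^ n" using N.lagrange[OF N.is_subgroup] n by (metis dvd_triv_right)
    then obtain m where m: "card N = p ^ m" using divides_primepow_nat[OF p] by auto
    have "card N \<noteq> 1"
    proof
      assume "card N = 1"
      then obtain a where "N = {a}" by (auto simp: card_1_singleton_iff)
      then show False using nontriv N.one_closed by auto
    qed
    then have "p dvd card N" "card N > 0" using m p by (auto simp: prime_gt_0_nat intro!: Nat.gr0I)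
    then have "p dvd 1" using 1 by (metis One_nat_def Suc_leI dvd_diffD1)
    then show False using p by simp
  qed
  then obtain z where z: "z \<in> N" "z \<noteq> \<one>\<^bsub>G\<^esub>" "\<And>g. g \<in> carrier G \<Longrightarrow> \<phi> g z = z" by blast
  moreover have "z \<otimes>\<^bsub>G\<^esub> g = g \<otimes>\<^bsub>G\<^esub> z" if g: "g \<in> carrier G" for g
  proof -
    have zc: "z \<in> carrier G" using z N.subset by auto
    have "g \<otimes>\<^bsub>G\<^esub> z \<otimes>\<^bsub>G\<^esub> inv\<^bsub>G\<^esub> g = z" using z(3)[OF g] zc by (simp add: \<phi>_def)
    then show ?thesis using g zc by (metis N.inv_solve_right N.m_closed)
  qed
  ultimately show ?thesis using that by blast
qed

text \<open>
Computations modulo \<open>K\<close> are done in the image of an abstract epimorphism \<open>q\<close> with kernel \<open>K\<close>, which keeps the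
simplifier away from products of cosets.
\<close>

lemma (in group) quotient_map:
  assumes "K \<lhd> G"
  obtains Q :: "'a set monoid" and q where "group_hom G Q q" "q ` carrier G = carrier Q"
    "\<And>a. a \<in> carrier G \<Longrightarrow> q a = \<one>\<^bsub>Q\<^esub> \<longleftrightarrow> a \<in> K"
    "\<And>p. finite_p_group p G \<Longrightarrow> finite_p_group p Q"
proof -
  interpret K: normal K G by (fact assms)
  show ?thesis
  proof (rule that)
    show "group_hom G (G Mod K) (\<lambda>a. K #> a)"
      using K.r_coset_hom_Mod K.factorgroup_is_group is_group
      by (simp add: group_hom_def group_hom_axioms_def)
    show "(\<lambda>a. K #> a) ` carrier G = carrier (G Mod K)"
      by (simp add: carrier_FactGroup)
    show "K #> a = \<one>\<^bsub>G Mod K\<^esub> \<longleftrightarrow> a \<in> K" if "a \<in> carrier G" for a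
      using coset_join1[OF _ that K.is_subgroup] coset_join2[OF that K.is_subgroup] by auto
    show "finite_p_group p (G Mod K)" if "finite_p_group p G" for p
      using that assms by (rule finite_p_group_quotient)
  qed
qed

context group
begin

lemma inv_mult_cancel:
  assumes "x \<in> carrier G" "y \<in> carrier G"
  shows "x \<otimes> (inv x \<otimes> y) = y" and "inv x \<otimes> (x \<otimes> y) = y"
  using assms by (simp_all flip: m_assoc)

lemma subgroup_pow_closed:
  assumes "subgroup H G" "h \<in> H"
  shows "h [^] (n::nat) \<in> H"
  using subgroup_int_pow_closed[OF assms, of "int n"] by (simp add: int_pow_int)

lemma commutator_closed [simp, intro]:
  "x \<in> carrier G \<Longrightarrow> y \<in> carrier G \<Longrightarrow> commutator G x y \<in> carrier G"
  by (simp add: commutator_def)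

lemma commutator_swap:
  assumes "x \<in> carrier G" "y \<in> carrier G"
  shows "x \<otimes> y = y \<otimes> x \<otimes> commutator G x y"
proof -
  show ?thesis using assms by (simp add: commutator_def m_assoc inv_mult_cancel)
qed

lemma commutator_eq_one_iff:
  assumes "x \<in> carrier G" "y \<in> carrier G"
  shows "commutator G x y = \<one> \<longleftrightarrow> x \<otimes> y = y \<otimes> x"
proof -
  have "commutator G x y = \<one> \<longleftrightarrow> y \<otimes> x \<otimes> commutator G x y = y \<otimes> x \<otimes> \<one>"
    using assms by (subst l_cancel) auto
  then show ?thesis using assms by (simp flip: commutator_swap)
qed

lemma commutator_mem_normal_left:
  assumes "N \<lhd> G" "x \<in> N" "g \<in> carrier G"
  shows "commutator G x g \<in> N"
proof -
  interpret N: normal N G by (fact assms)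
  have "commutator G x g = inv x \<otimes> (inv g \<otimes> x \<otimes> g)"
    using assms by (simp add: commutator_def m_assoc)
  then show ?thesis using assms N.inv_op_closed1 by auto
qed

end

lemma (in group_hom) hom_commutator:
  "x \<in> carrier G \<Longrightarrow> y \<in> carrier G \<Longrightarrow> h (commutator G x y) = commutator H (h x) (h y)"
  by (simp add: commutator_def)

lemma (in group_hom) subgroup_preimage:
  assumes "subgroup S H"
  shows "subgroup {g \<in> carrier G. h g \<in> S} G"
  using subgroup.one_closed[OF assms] subgroup.m_closed[OF assms] subgroup.m_inv_closed[OF assms]
  by (auto intro!: subgroup.intro)

text \<open>
The preimage of the elements of \<open>Z(G/K)\<close> killed by \<open>p\<close>. With exponent 0 in place of \<open>p\<close> it is the full
preimage of \<open>Z(G/K)\<close>.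
\<close>

definition central_layer :: "('a, 'b) monoid_scheme \<Rightarrow> nat \<Rightarrow> 'a set \<Rightarrow> 'a set" where
  "central_layer G p K =
     {g \<in> carrier G. g [^]\<^bsub>G\<^esub> p \<in> K \<and> (\<forall>h \<in> carrier G. commutator G g h \<in> K)}"

context group
begin

lemma central_layerD:
  assumes "g \<in> central_layer G p K"
  shows "g \<in> carrier G" "g [^] p \<in> K" "h \<in> carrier G \<Longrightarrow> commutator G g h \<in> K"
  using assms by (auto simp: central_layer_def)

lemma central_layer_normal:
  assumes "K \<lhd> G"
  shows "central_layer G p K \<lhd> G" and "K \<subseteq> central_layer G p K"
proof -
  interpret K: normal K G by (fact assms)
  from quotient_map[OF assms] obtain Q :: "'a set monoid" and q where
    hom: "group_hom G Q q" and q: "\<And>a. a \<in> carrier G \<Longrightarrow> q a = \<one>\<^bsub>Q\<^esub> \<longleftrightarrow> a \<in> K" by metis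
  interpret q: group_hom G Q q by (fact hom)
  define L where "L = {v \<in> q ` carrier G. v [^]\<^bsub>Q\<^esub> p = \<one>\<^bsub>Q\<^esub> \<and> (\<forall>w \<in> q ` carrier G. v \<otimes>\<^bsub>Q\<^esub> w = w \<otimes>\<^bsub>Q\<^esub> v)}"
  have comm: "commutator G g h \<in> K \<longleftrightarrow> q g \<otimes>\<^bsub>Q\<^esub> q h = q h \<otimes>\<^bsub>Q\<^esub> q g"
    if "g \<in> carrier G" "h \<in> carrier G" for g h
    using that q[of "commutator G g h"] by (simp add: q.hom_commutator q.H.commutator_eq_one_iff)
  have pow: "g [^] p \<in> K \<longleftrightarrow> q g [^]\<^bsub>Q\<^esub> p = \<one>\<^bsub>Q\<^esub>" if "g \<in> carrier G" for g
    using that q[of "g [^] p"] by (simp add: q.hom_nat_pow)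
  have eq: "central_layer G p K = {g \<in> carrier G. q g \<in> L}"
    by (auto simp: central_layer_def L_def comm pow)
  have LD: "v \<in> q ` carrier G" "v \<in> carrier Q" "v [^]\<^bsub>Q\<^esub> p = \<one>\<^bsub>Q\<^esub>"
      "w \<in> q ` carrier G \<Longrightarrow> v \<otimes>\<^bsub>Q\<^esub> w = w \<otimes>\<^bsub>Q\<^esub> v" if "v \<in> L" for v w
    using that unfolding L_def by auto
  have "subgroup L Q"
  proof (rule subgroup.intro)
    show "L \<subseteq> carrier Q" by (auto simp: L_def)
    show "\<one>\<^bsub>Q\<^esub> \<in> L" by (auto simp: L_def intro!: image_eqI[of _ q \<one>])
    fix v assume v: "v \<in> L"
    then obtain a where a: "a \<in> carrier G" "v = q a" using LD(1)[OF v] by auto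
    have "inv\<^bsub>Q\<^esub> v [^]\<^bsub>Q\<^esub> p = \<one>\<^bsub>Q\<^esub>" using LD(2,3)[OF v] by (simp add: q.H.nat_pow_inv)
    moreover have "inv\<^bsub>Q\<^esub> v \<otimes>\<^bsub>Q\<^esub> w = w \<otimes>\<^bsub>Q\<^esub> inv\<^bsub>Q\<^esub> v" if "w \<in> q ` carrier G" for w
    proof -
      have *: "v \<otimes>\<^bsub>Q\<^esub> w = w \<otimes>\<^bsub>Q\<^esub> v" "v \<in> carrier Q" "w \<in> carrier Q"
        using LD(2)[OF v] LD(4)[OF v that] that by auto
      then show ?thesis
        by (metis q.H.inv_closed q.H.inv_solve_left q.H.inv_solve_right q.H.m_assoc q.H.m_closed)
    qed
    moreover have "inv\<^bsub>Q\<^esub> v \<in> q ` carrier G" using a by (auto intro!: image_eqI[of _ q "inv a"])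
    ultimately show "inv\<^bsub>Q\<^esub> v \<in> L" by (auto simp: L_def)
    fix v' assume v': "v' \<in> L"
    then obtain a' where a': "a' \<in> carrier G" "v' = q a'" using LD(1)[OF v'] by auto
    have "v \<otimes>\<^bsub>Q\<^esub> v' = v' \<otimes>\<^bsub>Q\<^esub> v" using LD(4)[OF v LD(1)[OF v']] .
    then have "(v \<otimes>\<^bsub>Q\<^esub> v') [^]\<^bsub>Q\<^esub> p = \<one>\<^bsub>Q\<^esub>"
      using LD(2,3)[OF v] LD(2,3)[OF v'] q.H.pow_mult_distrib[of v v' p] by simp
    moreover have "(v \<otimes>\<^bsub>Q\<^esub> v') \<otimes>\<^bsub>Q\<^esub> w = w \<otimes>\<^bsub>Q\<^esub> (v \<otimes>\<^bsub>Q\<^esub> v')" if "w \<in> q ` carrier G" for w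
    proof -
      have "w \<otimes>\<^bsub>Q\<^esub> v = v \<otimes>\<^bsub>Q\<^esub> w" "w \<otimes>\<^bsub>Q\<^esub> v' = v' \<otimes>\<^bsub>Q\<^esub> w"
        "v \<in> carrier Q" "v' \<in> carrier Q" "w \<in> carrier Q"
        using LD(4)[OF v that] LD(4)[OF v' that] LD(2)[OF v] LD(2)[OF v'] that by auto
      then show ?thesis using q.H.commute_mult_right[of w v v'] by simp
    qed
    moreover have "v \<otimes>\<^bsub>Q\<^esub> v' \<in> q ` carrier G"
      using a a' by (auto intro!: image_eqI[of _ q "a \<otimes> a'"])
    ultimately show "v \<otimes>\<^bsub>Q\<^esub> v' \<in> L" by (auto simp: L_def)
  qed
  then have "subgroup (central_layer G p K) G" unfolding eq by (rule q.subgroup_preimage)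
  moreover have "g \<otimes> h \<otimes> inv g \<in> central_layer G p K"
    if "g \<in> carrier G" "h \<in> central_layer G p K" for g h
  proof -
    have h: "h \<in> carrier G" and L: "q h \<in> L" using that by (auto simp: eq)
    have "q h \<otimes>\<^bsub>Q\<^esub> q g = q g \<otimes>\<^bsub>Q\<^esub> q h" using LD(4)[OF L, of "q g"] that by simp
    then have "q (g \<otimes> h \<otimes> inv g) = q h"
      using that h by (simp add: q.H.inv_solve_right')
    then show ?thesis using L that h by (simp add: eq)
  qed
  ultimately show "central_layer G p K \<lhd> G" by (auto simp: normal_inv_iff)
  show "K \<subseteq> central_layer G p K"
    using K.subset subgroup_pow_closed[OF K.is_subgroup] commutator_mem_normal_left[OF assms]
    by (auto simp: central_layer_def)
qed

text \<open>
The image of \<open>A\<close> in the \<open>p\<close>-group \<open>G/K\<close> contains a nontrivial central element, and the last nontrivial one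
among its iterated \<open>p\<close>-th powers has order \<open>p\<close>.
\<close>

lemma central_layer_meets_normal:
  assumes p: "finite_p_group p G" and K: "K \<lhd> G" and A: "A \<lhd> G" and "\<not> A \<subseteq> K"
  obtains z where "z \<in> A" "z \<in> central_layer G p K" "z \<notin> K"
proof -
  interpret A: normal A G by (fact A)
  from quotient_map[OF K] obtain Q :: "'a set monoid" and q where
    hom: "group_hom G Q q" and surj: "q ` carrier G = carrier Q"
    and q: "\<And>a. a \<in> carrier G \<Longrightarrow> q a = \<one>\<^bsub>Q\<^esub> \<longleftrightarrow> a \<in> K"
    and Qp: "\<And>p. finite_p_group p G \<Longrightarrow> finite_p_group p Q" by metis
  interpret q: group_hom G Q q by (fact hom)
  have Q: "finite_p_group p Q" using Qp p by simp
  have "q ` A \<lhd> Q" using A.surj_hom_normal_subgroup[OF hom surj] .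
  moreover have "q ` A \<noteq> {\<one>\<^bsub>Q\<^esub>}"
  proof -
    obtain a where "a \<in> A" "a \<notin> K" using assms(4) by auto
    then show ?thesis using q[of a] A.subset by auto
  qed
  ultimately obtain w where "w \<in> q ` A" "w \<noteq> \<one>\<^bsub>Q\<^esub>"
    and w: "\<And>g. g \<in> carrier Q \<Longrightarrow> w \<otimes>\<^bsub>Q\<^esub> g = g \<otimes>\<^bsub>Q\<^esub> w"
    using p_group_normal_meets_center[OF Q, of "q ` A" thesis] by blast
  then obtain a where a: "a \<in> A" "w = q a" by auto
  have ac: "a \<in> carrier G" using a A.subset by auto
  obtain n where "order Q = p ^ n" using Q by (auto simp: finite_p_group_def)
  then have ex: "w [^]\<^bsub>Q\<^esub> (p ^ n) = \<one>\<^bsub>Q\<^esub>" using q.H.pow_order_eq_1[of w] a ac by simp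
  define k where "k = (LEAST k. w [^]\<^bsub>Q\<^esub> (p ^ k) = \<one>\<^bsub>Q\<^esub>)"
  have k: "w [^]\<^bsub>Q\<^esub> (p ^ k) = \<one>\<^bsub>Q\<^esub>" unfolding k_def by (rule LeastI[of _ n], rule ex)
  have wc: "w \<in> carrier Q" using a ac by simp
  have "k \<noteq> 0"
  proof
    assume "k = 0"
    then have "w [^]\<^bsub>Q\<^esub> (1::nat) = \<one>\<^bsub>Q\<^esub>" using k by (metis power_0)
    then show False using \<open>w \<noteq> \<one>\<^bsub>Q\<^esub>\<close> wc by simp
  qed
  then obtain j where j: "k = Suc j" by (cases k) auto
  define z where "z = a [^] (p ^ j)"
  have zc: "z \<in> carrier G" using ac by (simp add: z_def)
  have qz: "q z = w [^]\<^bsub>Q\<^esub> (p ^ j)" using a ac by (simp add: z_def q.hom_nat_pow)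
  have "z \<in> A" using subgroup_int_pow_closed[OF A.is_subgroup a(1), of "int (p ^ j)"]
    by (simp add: z_def flip: int_pow_int)
  moreover have "z \<notin> K"
  proof
    assume "z \<in> K"
    then have "w [^]\<^bsub>Q\<^esub> (p ^ j) = \<one>\<^bsub>Q\<^esub>" using q[OF zc] qz by simp
    then have "k \<le> j" unfolding k_def by (rule Least_le)
    then show False using j by simp
  qed
  moreover have "z \<in> central_layer G p K"
    unfolding central_layer_def
  proof (intro CollectI conjI ballI)
    have "q (z [^] p) = w [^]\<^bsub>Q\<^esub> (p ^ k)"
      using zc a ac by (simp add: q.hom_nat_pow qz q.H.nat_pow_pow j mult.commute)
    then show "z [^] p \<in> K" using k q[of "z [^] p"] zc by simp
    fix h assume h: "h \<in> carrier G"
    have "q z \<otimes>\<^bsub>Q\<^esub> q h = q h \<otimes>\<^bsub>Q\<^esub> q z"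
      using w[of "q h"] q.H.group_commutes_pow[of w "q h"] a ac h qz by simp
    then show "commutator G z h \<in> K"
      using q[of "commutator G z h"] h zc by (simp add: q.hom_commutator q.H.commutator_eq_one_iff)
  qed (fact zc)
  ultimately show ?thesis using that by blast
qed

text \<open>
To prove \<open>A \<subseteq> B\<close> one may enlarge \<open>B\<close> to a normal subgroup \<open>K\<close> modulo which \<open>A\<close> is central of exponent \<open>p\<close>.
A counterexample would have a maximal normal \<open>K \<supseteq> B\<close> with \<open>\<not> A \<subseteq> K\<close>; since \<open>A\<close> meets the central layer
outside \<open>K\<close>, that layer is strictly larger than \<open>K\<close> and so contains \<open>A\<close>.
This is how nilpotency of \<open>p\<close>-groups enters all later arguments.
\<close>

theorem normal_subset_by_central_layer:
  assumes p: "finite_p_group p G" and A: "A \<lhd> G" and B: "B \<lhd> G"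
    and step: "\<And>K. K \<lhd> G \<Longrightarrow> B \<subseteq> K \<Longrightarrow> A \<subseteq> central_layer G p K \<Longrightarrow> A \<subseteq> K"
  shows "A \<subseteq> B"
proof (rule ccontr)
  assume "\<not> A \<subseteq> B"
  define S where "S = {K. K \<lhd> G \<and> B \<subseteq> K \<and> \<not> A \<subseteq> K}"
  have fin: "finite (carrier G)" using p by (simp add: finite_p_group_def)
  have "S \<subseteq> Pow (carrier G)" using normal_imp_subgroup subgroup.subset by (fastforce simp: S_def)
  then have "finite S" using fin finite_subset by auto
  moreover have "S \<noteq> {}" using B \<open>\<not> A \<subseteq> B\<close> by (auto simp: S_def)
  ultimately obtain K where "K \<in> S" and max: "\<And>K'. K' \<in> S \<Longrightarrow> K \<subseteq> K' \<Longrightarrow> K' = K"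
    using finite_has_maximal[of S] by metis
  then have K: "K \<lhd> G" "B \<subseteq> K" "\<not> A \<subseteq> K" by (auto simp: S_def)
  obtain z where "z \<in> A" "z \<in> central_layer G p K" "z \<notin> K"
    using central_layer_meets_normal[OF p K(1) A K(3)] .
  then have "central_layer G p K \<notin> S" using max central_layer_normal(2)[OF K(1)] by metis
  then have "A \<subseteq> central_layer G p K"
    using central_layer_normal[OF K(1), of p] K(2) by (auto simp: S_def)
  then show False using step[OF K(1,2)] K(3) by blast
qed

end

section \<open>Maximal subgroups\<close>

context group
begin

lemma exists_maximal_subgroup:
  assumes "finite (carrier G)" "subgroup H G" "H \<noteq> carrier G"
  obtains M where "maximal_subgroup M G" "H \<subseteq> M"
proof -
  define S where "S = {M. subgroup M G \<and> H \<subseteq> M \<and> M \<noteq> carrier G}"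
  have "S \<subseteq> Pow (carrier G)" using subgroup.subset by (fastforce simp: S_def)
  then have "finite S" using assms(1) finite_subset by auto
  moreover have "S \<noteq> {}" using assms by (auto simp: S_def)
  ultimately obtain M where M: "M \<in> S" "\<And>M'. M' \<in> S \<Longrightarrow> M \<subseteq> M' \<Longrightarrow> M' = M"
    using finite_has_maximal[of S] by metis
  have "maximal_subgroup M G"
    unfolding maximal_subgroup_def
  proof (intro conjI allI impI)
    fix K assume "subgroup K G" "M \<subseteq> K"
    then show "K = M \<or> K = carrier G" using M by (auto simp: S_def)
  qed (use M(1) in \<open>auto simp: S_def\<close>)
  then show ?thesis using that M(1) by (auto simp: S_def)
qed

text \<open>
Let \<open>K\<close> be the largest normal subgroup of \<open>G\<close> inside \<open>M\<close>. The elements that are central of order dividing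
\<open>p\<close> modulo \<open>K\<close> form a larger normal subgroup, so one of them, \<open>z\<close>, lies outside \<open>M\<close>.
The normalizer of \<open>M\<close> then contains \<open>M\<close> and \<open>z\<close>, so it is \<open>G\<close>.
\<close>

lemma maximal_subgroup_normal:
  assumes p: "finite_p_group p G" and M: "maximal_subgroup M G"
  obtains z where "M \<lhd> G" "z \<in> carrier G" "z \<notin> M" "z [^] p \<in> M"
proof -
  interpret M: subgroup M G using M by (simp add: maximal_subgroup_def)
  define S where "S = {K. K \<lhd> G \<and> K \<subseteq> M}"
  have fin: "finite (carrier G)" using p by (simp add: finite_p_group_def)
  have "S \<subseteq> Pow (carrier G)" using M.subset by (auto simp: S_def)
  then have "finite S" using fin finite_subset by auto
  moreover have "{\<one>} \<in> S" using one_is_normal by (auto simp: S_def)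
  ultimately obtain K where "K \<in> S" and max: "\<And>K'. K' \<in> S \<Longrightarrow> K \<subseteq> K' \<Longrightarrow> K' = K"
    using finite_has_maximal[of S] by (metis empty_iff)
  then have K: "K \<lhd> G" "K \<subseteq> M" by (auto simp: S_def)
  have "\<not> carrier G \<subseteq> K" using K M M.subset by (auto simp: maximal_subgroup_def)
  then obtain y where "y \<in> central_layer G p K" "y \<notin> K"
    using central_layer_meets_normal[OF p K(1) normal_self] by metis
  then have "central_layer G p K \<notin> S" using max central_layer_normal(2)[OF K(1)] by metis
  then obtain z where z: "z \<in> central_layer G p K" "z \<notin> M"
    using central_layer_normal[OF K(1), of p] by (auto simp: S_def)
  then have zc: "z \<in> carrier G" and zp: "z [^] p \<in> M" using K(2) central_layerD[OF z(1)] by blast+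
  \<comment> \<open>the normalizer of \<open>M\<close>; the equivalence makes closure under inverses immediate\<close>
  define N where "N = {g \<in> carrier G. \<forall>m \<in> carrier G. g \<otimes> m \<otimes> inv g \<in> M \<longleftrightarrow> m \<in> M}"
  have "subgroup N G"
  proof (rule subgroup.intro)
    show "N \<subseteq> carrier G" "\<one> \<in> N" by (auto simp: N_def)
    fix g assume g: "g \<in> N"
    then have gc: "g \<in> carrier G" by (simp add: N_def)
    have "inv g \<otimes> m \<otimes> inv (inv g) \<in> M \<longleftrightarrow> m \<in> M" if "m \<in> carrier G" for m
    proof -
      have "g \<otimes> (inv g \<otimes> m \<otimes> inv (inv g)) \<otimes> inv g = m"
        using that gc by (simp add: m_assoc inv_mult_cancel)
      moreover have "inv g \<otimes> m \<otimes> inv (inv g) \<in> carrier G" using that gc by simp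
      ultimately show ?thesis using g unfolding N_def by force
    qed
    then show "inv g \<in> N" using gc by (simp add: N_def)
    fix h assume h: "h \<in> N"
    then have hc: "h \<in> carrier G" by (simp add: N_def)
    have "g \<otimes> h \<otimes> m \<otimes> inv (g \<otimes> h) = g \<otimes> (h \<otimes> m \<otimes> inv h) \<otimes> inv g" if "m \<in> carrier G" for m
      using that gc hc by (simp add: m_assoc inv_mult_group)
    then show "g \<otimes> h \<in> N" using g h gc hc by (simp add: N_def)
  qed
  moreover have "M \<subseteq> N"
  proof
    fix g assume g: "g \<in> M"
    have "m \<in> M" if "m \<in> carrier G" "g \<otimes> m \<otimes> inv g \<in> M" for m
    proof -
      have "inv g \<otimes> (g \<otimes> m \<otimes> inv g) \<otimes> g = m"
        using that g by (simp add: m_assoc inv_mult_cancel)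
      then show ?thesis using M.m_closed[OF M.m_closed[OF M.m_inv_closed[OF g] that(2)] g] by metis
    qed
    moreover have "g \<otimes> m \<otimes> inv g \<in> M" if "m \<in> M" for m
      using M.m_closed[OF M.m_closed[OF g that] M.m_inv_closed[OF g]] .
    ultimately have "g \<otimes> m \<otimes> inv g \<in> M \<longleftrightarrow> m \<in> M" if "m \<in> carrier G" for m
      using that by metis
    moreover have "g \<in> carrier G" using g M.subset by (rule rev_subsetD)
    ultimately show "g \<in> N" unfolding N_def by blast
  qed
  moreover have "z \<in> N"
  proof -
    have "z \<otimes> m \<otimes> inv z \<in> M \<longleftrightarrow> m \<in> M" if m: "m \<in> carrier G" for m
    proof -
      have c: "commutator G (inv z) (inv m) = z \<otimes> m \<otimes> inv z \<otimes> inv m"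
        using m zc by (simp add: commutator_def)
      interpret L: normal "central_layer G p K" G using central_layer_normal(1)[OF K(1)] .
      have "inv z \<in> central_layer G p K" using z(1) by (rule L.m_inv_closed)
      then have "commutator G (inv z) (inv m) \<in> M"
        using K(2) central_layerD(3)[of "inv z" p K "inv m"] m by blast
      define d where "d = commutator G (inv z) (inv m)"
      have dM: "d \<in> M" unfolding d_def by fact
      have dm: "z \<otimes> m \<otimes> inv z = d \<otimes> m"
        using m zc by (simp add: c d_def m_assoc)
      have "inv d \<otimes> (d \<otimes> m) = m" using m M.mem_carrier[OF dM] by (rule inv_mult_cancel(2)[rotated])
      then have "m \<in> M" if "d \<otimes> m \<in> M" using M.m_closed[OF M.m_inv_closed[OF dM] that] by simp
      then show ?thesis unfolding dm using M.m_closed[OF dM] by blast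
    qed
    then show ?thesis using zc by (simp add: N_def)
  qed
  ultimately have NG: "N = carrier G" using M z(2) unfolding maximal_subgroup_def by blast
  have "g \<otimes> m \<otimes> inv g \<in> M" if "g \<in> carrier G" "m \<in> M" for g m
    using that M.subset unfolding NG[symmetric] unfolding N_def by blast
  then have "M \<lhd> G" using M.is_subgroup unfolding normal_inv_iff by blast
  then show ?thesis using that zc z(2) zp by blast
qed

text \<open>
By maximality \<open>x\<close> and \<open>M\<close> generate \<open>G\<close>, so \<open>G/M\<close> is cyclic and generated by the coset of \<open>x\<close>.
\<close>

lemma maximal_normal_coset_powers:
  assumes fin: "finite (carrier G)" and M: "maximal_subgroup M G" "M \<lhd> G"
    and x: "x \<in> carrier G" "x \<notin> M" and g: "g \<in> carrier G"
  obtains i :: nat and m where "m \<in> M" "g = x [^] i \<otimes> m"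
proof -
  interpret M: normal M G by (fact M)
  from quotient_map[OF M(2)] obtain Q :: "'a set monoid" and q where
    hom: "group_hom G Q q" and surj: "q ` carrier G = carrier Q"
    and q: "\<And>a. a \<in> carrier G \<Longrightarrow> q a = \<one>\<^bsub>Q\<^esub> \<longleftrightarrow> a \<in> M" by metis
  interpret q: group_hom G Q q by (fact hom)
  define T where "T = {g \<in> carrier G. q g \<in> generate Q {q x}}"
  have "subgroup T G" unfolding T_def
    using x by (intro q.subgroup_preimage q.H.generate_is_subgroup) auto
  moreover have "M \<subseteq> T"
  proof
    fix m assume "m \<in> M"
    then have "q m = \<one>\<^bsub>Q\<^esub>" using q by auto
    then show "m \<in> T" using \<open>m \<in> M\<close> generate.one[of Q] by (auto simp: T_def)
  qed
  moreover have "x \<in> T" using x by (auto simp: T_def intro: generate.incl)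
  ultimately have "T = carrier G" using M(1) x by (auto simp: maximal_subgroup_def)
  then have "q g \<in> generate Q {q x}" using g by (auto simp: T_def)
  moreover have "finite (carrier Q)" using surj fin by (metis finite_imageI)
  ultimately obtain i :: nat where i: "q g = q x [^]\<^bsub>Q\<^esub> i"
    using q.H.generate_pow_on_finite_carrier[of "q x"] x by auto
  have "q (inv (x [^] i) \<otimes> g) = \<one>\<^bsub>Q\<^esub>" using x g i by (simp add: q.hom_nat_pow)
  then have "inv (x [^] i) \<otimes> g \<in> M" using q[of "inv (x [^] i) \<otimes> g"] x g by (simp del: q.hom_mult)
  moreover have "g = x [^] i \<otimes> (inv (x [^] i) \<otimes> g)"
    using x g by (simp add: inv_mult_cancel)
  ultimately show ?thesis using that by blast
qed

end

text \<open>
The quotient \<open>G/M\<close> is generated by one element whose \<open>p\<close>-th power is trivial, hence it is abelian of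
exponent \<open>p\<close>.
\<close>

lemma (in group) maximal_subgroup_contains:
  assumes p: "finite_p_group p G" and M: "maximal_subgroup M G"
  shows "M \<lhd> G" and "g \<in> carrier G \<Longrightarrow> g [^] p \<in> M"
    and "g \<in> carrier G \<Longrightarrow> h \<in> carrier G \<Longrightarrow> commutator G g h \<in> M"
proof -
  obtain z where N: "M \<lhd> G" and z: "z \<in> carrier G" "z \<notin> M" "z [^] p \<in> M"
    using maximal_subgroup_normal[OF p M] .
  have fin: "finite (carrier G)" using p by (simp add: finite_p_group_def)
  from quotient_map[OF N] obtain Q :: "'a set monoid" and q where
    hom: "group_hom G Q q" and q: "\<And>a. a \<in> carrier G \<Longrightarrow> q a = \<one>\<^bsub>Q\<^esub> \<longleftrightarrow> a \<in> M" by metis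
  interpret q: group_hom G Q q by (fact hom)
  interpret M: normal M G by (fact N)
  have pow: "\<exists>i::nat. q g = q z [^]\<^bsub>Q\<^esub> i" if "g \<in> carrier G" for g
  proof -
    obtain i :: nat and m where "m \<in> M" "g = z [^] i \<otimes> m"
      using maximal_normal_coset_powers[OF fin M N z(1,2) \<open>g \<in> carrier G\<close>] .
    moreover have "q m = \<one>\<^bsub>Q\<^esub>" using q[of m] \<open>m \<in> M\<close> by simp
    ultimately show ?thesis using z by (auto simp: q.hom_nat_pow)
  qed
  have qz: "q z [^]\<^bsub>Q\<^esub> p = \<one>\<^bsub>Q\<^esub>" using q[of "z [^] p"] z by (simp add: q.hom_nat_pow)
  show "M \<lhd> G" by (fact N)
  show "g [^] p \<in> M" if g: "g \<in> carrier G"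
  proof -
    obtain i :: nat where i: "q g = q z [^]\<^bsub>Q\<^esub> i" using pow[OF g] by blast
    have "q (g [^] p) = (q z [^]\<^bsub>Q\<^esub> p) [^]\<^bsub>Q\<^esub> i"
      using g i z by (simp add: q.hom_nat_pow q.H.nat_pow_pow mult.commute)
    then show ?thesis using qz q g by simp
  qed
  show "commutator G g h \<in> M" if g: "g \<in> carrier G" and h: "h \<in> carrier G"
  proof -
    obtain i j :: nat where "q g = q z [^]\<^bsub>Q\<^esub> i" "q h = q z [^]\<^bsub>Q\<^esub> j" using pow[OF g] pow[OF h] by blast
    then have "q g \<otimes>\<^bsub>Q\<^esub> q h = q h \<otimes>\<^bsub>Q\<^esub> q g" using z by (simp add: q.H.nat_pow_mult add.commute)
    then show ?thesis using q[of "commutator G g h"] g h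
      by (simp add: q.hom_commutator q.H.commutator_eq_one_iff)
  qed
qed

lemma (in group) mem_subgroup_if_coprime_power:
  assumes H: "subgroup H G" and p: "Factorial_Ring.prime p" and x: "x \<in> carrier G"
    and "x [^] p \<in> H" "x [^] (i::nat) \<in> H" "\<not> p dvd i"
  shows "x \<in> H"
proof -
  have "coprime (int i) (int p)" using assms
    by (metis coprime_commute coprime_int_iff prime_imp_coprime)
  then obtain u v where uv: "u * int i + v * int p = 1"
    using bezout_int[of "int i" "int p"] by auto
  have "(x [^] i) [^] u \<otimes> (x [^] p) [^] v = x [^] (u * int i + v * int p)"
    using x by (simp add: int_pow_pow mult.commute flip: int_pow_int int_pow_mult)
  also have "\<dots> = x" using x by (simp add: uv)
  finally show ?thesis
    using assms subgroup_int_pow_closed[OF H] subgroup.m_closed[OF H] by metis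
qed

section \<open>Subgroups generated by powers\<close>

context group
begin

lemma power_span_subgroup: "S \<subseteq> carrier G \<Longrightarrow> subgroup (power_span G n S) G"
  unfolding power_span_def by (rule generate_is_subgroup) auto

lemma power_span_mem: "x \<in> S \<Longrightarrow> x [^] n \<in> power_span G n S"
  unfolding power_span_def by (blast intro: generate.incl)

lemma power_span_least:
  "subgroup H G \<Longrightarrow> (\<And>x. x \<in> S \<Longrightarrow> x [^] n \<in> H) \<Longrightarrow> power_span G n S \<subseteq> H"
  unfolding power_span_def by (rule generate_subgroup_incl) auto

lemma power_span_subset: "subgroup H G \<Longrightarrow> power_span G n H \<subseteq> H"
  by (rule power_span_least) (auto intro: subgroup_pow_closed)

lemma power_span_mono: "S \<subseteq> T \<Longrightarrow> power_span G n S \<subseteq> power_span G n T"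
  unfolding power_span_def by (intro mono_generate image_mono)

lemma conjugate_pow:
  assumes "g \<in> carrier G" "x \<in> carrier G"
  shows "(g \<otimes> x \<otimes> inv g) [^] (n::nat) = g \<otimes> x [^] n \<otimes> inv g"
  using assms by (induction n) (simp_all add: m_assoc inv_mult_cancel)

lemma power_span_normal:
  assumes "N \<lhd> G"
  shows "power_span G n N \<lhd> G"
proof -
  interpret N: normal N G by (fact assms)
  show ?thesis unfolding power_span_def
  proof (rule normal_generateI)
    show "(\<lambda>x. x [^] n) ` N \<subseteq> carrier G" using N.subset by auto
    fix h g assume "h \<in> (\<lambda>x. x [^] n) ` N" and g: "g \<in> carrier G"
    then obtain x where x: "x \<in> N" "h = x [^] n" by blast
    then have "g \<otimes> h \<otimes> inv g = (g \<otimes> x \<otimes> inv g) [^] n"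
      using g N.subset by (simp add: conjugate_pow subset_iff)
    then show "g \<otimes> h \<otimes> inv g \<in> (\<lambda>x. x [^] n) ` N"
      using N.inv_op_closed2[OF g x(1)] by blast
  qed
qed

lemma power_span_consistent:
  assumes "subgroup H G" "S \<subseteq> H"
  shows "power_span (G\<lparr>carrier := H\<rparr>) n S = power_span G n S"
proof -
  have "(\<lambda>x. x [^] n) ` S \<subseteq> H" using assms subgroup_pow_closed by blast
  then show ?thesis
    unfolding power_span_def using generate_consistent[OF _ assms(1)] by (simp add: nat_pow_consistent[symmetric])
qed

lemma commutator_consistent:
  assumes "subgroup H G" "x \<in> H" "y \<in> H"
  shows "commutator (G\<lparr>carrier := H\<rparr>) x y = commutator G x y"
  using assms by (simp add: commutator_def m_inv_consistent)

lemma agemo_eq_power_span: "agemo p k G = power_span G (p ^ k) (carrier G)"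
  unfolding agemo_def power_span_def by (rule arg_cong[of _ _ "generate G"]) blast

end

lemma (in group) powerful_iff_commutators:
  "powerful p G \<longleftrightarrow> finite_p_group p G \<and>
     (\<forall>x \<in> carrier G. \<forall>y \<in> carrier G. commutator G x y \<in> power_span G p (carrier G))"
proof (cases "finite_p_group p G")
  case True
  have sub: "subgroup (power_span G p (carrier G)) G" by (rule power_span_subgroup) simp
  have ag: "agemo p (Suc 0) G = power_span G p (carrier G)" by (simp add: agemo_eq_power_span)
  show ?thesis
  proof
    assume "powerful p G"
    then have D: "derived G (carrier G) \<subseteq> power_span G p (carrier G)" by (simp add: powerful_def ag)
    have "commutator G x y \<in> derived G (carrier G)" if "x \<in> carrier G" "y \<in> carrier G" for x y
    proof -
      have "commutator G x y = inv x \<otimes> inv y \<otimes> inv (inv x) \<otimes> inv (inv y)"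
        using that by (simp add: commutator_def)
      moreover have "inv x \<in> carrier G" "inv y \<in> carrier G" using that by auto
      ultimately show ?thesis unfolding derived_def by (blast intro: generate.incl)
    qed
    then show "finite_p_group p G \<and>
       (\<forall>x \<in> carrier G. \<forall>y \<in> carrier G. commutator G x y \<in> power_span G p (carrier G))"
      using D True by blast
  next
    assume R: "finite_p_group p G \<and>
       (\<forall>x \<in> carrier G. \<forall>y \<in> carrier G. commutator G x y \<in> power_span G p (carrier G))"
    have "x \<otimes> y \<otimes> inv x \<otimes> inv y \<in> power_span G p (carrier G)"
      if "x \<in> carrier G" "y \<in> carrier G" for x y
    proof -
      have "x \<otimes> y \<otimes> inv x \<otimes> inv y = commutator G (inv x) (inv y)"
        using that by (simp add: commutator_def)
      then show ?thesis using R that by simp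
    qed
    then have "derived G (carrier G) \<subseteq> power_span G p (carrier G)"
      unfolding derived_def by (intro generate_subgroup_incl sub) auto
    then show "powerful p G" using True by (simp add: powerful_def ag)
  qed
qed (simp add: powerful_def)

section \<open>Powers modulo a normal subgroup\<close>

lemma odd_prime_dvd_choose_two:
  assumes "Factorial_Ring.prime p" "odd p"
  shows "p dvd (p choose 2)"
proof -
  have "2 < p" using assms prime_ge_2_nat[of p] by (cases "p = 2") auto
  then show ?thesis using assms by (intro dvd_choose_prime) auto
qed

context group
begin

lemma pow_dvd_mem:
  assumes "subgroup H G" "x \<in> carrier G" "x [^] p \<in> H" "p dvd (m::nat)"
  shows "x [^] m \<in> H"
proof -
  obtain k where "m = p * k" using assms(4) by blast
  then have "x [^] m = (x [^] p) [^] k" using assms(2) by (simp add: nat_pow_pow)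
  then show ?thesis using subgroup_pow_closed[OF assms(1,3)] by simp
qed

text \<open>
The collection formula in \<open>G/K\<close>. All powers with exponent \<open>p choose 2\<close> disappear because \<open>p\<close> is odd; only
those with exponent \<open>p choose 3\<close> remain, and they matter exactly for \<open>p = 3\<close>.
\<close>

lemma pow_mult_mod:
  assumes K: "K \<lhd> G" and p: "Factorial_Ring.prime p" "odd p"
    and x: "x \<in> carrier G" and y: "y \<in> carrier G"
    and c: "c = commutator G y x" "c [^] p \<in> K"
    and u: "u = commutator G c x" "u \<in> central_layer G p K"
    and v: "v = commutator G c y" "v \<in> central_layer G p K"
  shows "\<exists>k\<in>K. (x \<otimes> y) [^] p = x [^] p \<otimes> y [^] p \<otimes> u [^] (p choose 3) \<otimes> v [^] (2 * (p choose 3)) \<otimes> k"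
proof -
  interpret K: normal K G by (fact K)
  from quotient_map[OF K] obtain Q :: "'a set monoid" and q where
    hom: "group_hom G Q q" and surj: "q ` carrier G = carrier Q"
    and q: "\<And>a. a \<in> carrier G \<Longrightarrow> q a = \<one>\<^bsub>Q\<^esub> \<longleftrightarrow> a \<in> K" by metis
  interpret q: group_hom G Q q by (fact hom)
  have cc: "c \<in> carrier G" and uc: "u \<in> carrier G" and vc: "v \<in> carrier G"
    using x y c(1) u(1) v(1) by simp_all
  have swap: "q (commutator G a b) = d \<Longrightarrow> q a \<otimes>\<^bsub>Q\<^esub> q b = q b \<otimes>\<^bsub>Q\<^esub> q a \<otimes>\<^bsub>Q\<^esub> d"
    if "a \<in> carrier G" "b \<in> carrier G" for a b d
    using that q.H.commutator_swap[of "q a" "q b"] by (simp add: q.hom_commutator)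
  have central: "q w \<otimes>\<^bsub>Q\<^esub> g = g \<otimes>\<^bsub>Q\<^esub> q w" if "w \<in> central_layer G p K" "g \<in> carrier Q" for w g
  proof -
    obtain h where h: "h \<in> carrier G" "g = q h" using surj \<open>g \<in> carrier Q\<close> by blast
    have "commutator G w h \<in> K" "w \<in> carrier G" using central_layerD[OF that(1)] h by auto
    then have "q (commutator G w h) = \<one>\<^bsub>Q\<^esub>" using q h by simp
    then show ?thesis using h \<open>w \<in> carrier G\<close> by (simp add: q.hom_commutator q.H.commutator_eq_one_iff)
  qed
  have triv: "q (w [^] m) = \<one>\<^bsub>Q\<^esub>" if "w \<in> carrier G" "w [^] p \<in> K" "p dvd m" for w and m :: nat
    using q[of "w [^] m"] pow_dvd_mem[OF K.is_subgroup that] that by simp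
  note two = odd_prime_dvd_choose_two[OF p]
  have "q ((x \<otimes> y) [^] p) = q x [^]\<^bsub>Q\<^esub> p \<otimes>\<^bsub>Q\<^esub> q y [^]\<^bsub>Q\<^esub> p \<otimes>\<^bsub>Q\<^esub> q c [^]\<^bsub>Q\<^esub> (p choose 2)
      \<otimes>\<^bsub>Q\<^esub> q u [^]\<^bsub>Q\<^esub> (p choose 3) \<otimes>\<^bsub>Q\<^esub> q v [^]\<^bsub>Q\<^esub> ((p choose 2) + 2 * (p choose 3))"
    unfolding q.hom_nat_pow[OF m_closed[OF x y]] q.hom_mult[OF x y]
    using x y cc uc vc swap[OF y x] swap[OF cc x] swap[OF cc y] c(1) u v central
    by (intro q.H.pow_mult_class3) auto
  also have "q c [^]\<^bsub>Q\<^esub> (p choose 2) = \<one>\<^bsub>Q\<^esub>"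
    using triv[OF cc c(2) two] cc by (simp add: q.hom_nat_pow)
  also have "q v [^]\<^bsub>Q\<^esub> ((p choose 2) + 2 * (p choose 3)) = q v [^]\<^bsub>Q\<^esub> (2 * (p choose 3))"
  proof -
    have "q v [^]\<^bsub>Q\<^esub> (p choose 2) = \<one>\<^bsub>Q\<^esub>"
      using triv[OF vc central_layerD(2)[OF v(2)] two] vc by (simp add: q.hom_nat_pow)
    then show ?thesis using vc by (simp flip: q.H.nat_pow_mult)
  qed
  finally have eq: "q ((x \<otimes> y) [^] p) =
      q (x [^] p \<otimes> y [^] p \<otimes> u [^] (p choose 3) \<otimes> v [^] (2 * (p choose 3)))" (is "_ = q ?r")
    using x y uc vc by (simp add: q.hom_nat_pow)
  have rc: "?r \<in> carrier G" using x y uc vc by simp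
  have xyc: "(x \<otimes> y) [^] p \<in> carrier G" using x y by simp
  have "q (inv ?r \<otimes> (x \<otimes> y) [^] p) = inv\<^bsub>Q\<^esub> (q ?r) \<otimes>\<^bsub>Q\<^esub> q ((x \<otimes> y) [^] p)"
    using rc xyc by (simp only: q.hom_mult q.hom_inv inv_closed)
  also have "\<dots> = \<one>\<^bsub>Q\<^esub>" unfolding eq using rc by (simp del: q.hom_mult)
  finally have "inv ?r \<otimes> (x \<otimes> y) [^] p \<in> K"
    using q[of "inv ?r \<otimes> (x \<otimes> y) [^] p"] rc xyc by (metis inv_closed m_closed)
  moreover have "(x \<otimes> y) [^] p = ?r \<otimes> (inv ?r \<otimes> (x \<otimes> y) [^] p)"
    using inv_mult_cancel(1)[OF rc xyc] by simp
  ultimately show ?thesis by blast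
qed

corollary pow_mult_mod_central:
  assumes K: "K \<lhd> G" and p: "Factorial_Ring.prime p" "odd p"
    and x: "x \<in> carrier G" and y: "y \<in> carrier G"
    and c: "commutator G y x \<in> central_layer G p K"
  shows "\<exists>k\<in>K. (x \<otimes> y) [^] p = x [^] p \<otimes> y [^] p \<otimes> k"
proof -
  interpret K: normal K G by (fact K)
  define c u v where "c = commutator G y x" and "u = commutator G c x" and "v = commutator G c y"
  have u: "u \<in> K" and v: "v \<in> K"
    using c x y central_layerD(3)[OF c] by (simp_all add: u_def v_def c_def)
  moreover have "c [^] p \<in> K" using central_layerD(2)[OF c] by (simp add: c_def)
  moreover note central_layer_normal(2)[OF K, of p]
  ultimately obtain k where k: "k \<in> K"
    "(x \<otimes> y) [^] p = x [^] p \<otimes> y [^] p \<otimes> u [^] (p choose 3) \<otimes> v [^] (2 * (p choose 3)) \<otimes> k"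
    using pow_mult_mod[OF K p x y c_def _ u_def _ v_def] by blast
  have "u [^] (p choose 3) \<otimes> (v [^] (2 * (p choose 3)) \<otimes> k) \<in> K"
    using u v k(1) by (intro K.m_closed subgroup_pow_closed[OF K.is_subgroup])
  moreover have "(x \<otimes> y) [^] p = x [^] p \<otimes> y [^] p \<otimes> (u [^] (p choose 3) \<otimes> (v [^] (2 * (p choose 3)) \<otimes> k))"
    using x y u v k K.subset by (simp add: m_assoc subset_iff)
  ultimately show ?thesis by blast
qed

section \<open>Powerfully embedded subgroups\<close>

text \<open>
If \<open>[N, G] \<subseteq> N\<^sup>p\<close>, then the same inclusion holds for \<open>N\<^sup>p\<close> in place of \<open>N\<close>: a powerfully embedded
subgroup has a powerfully embedded subgroup of \<open>p\<close>-th powers. The target may be enlarged to a \<open>K\<close> modulo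
which \<open>[N\<^sup>p, G]\<close> is central of exponent \<open>p\<close>. For \<open>n \<in> N\<close> and \<open>d = [n, g] \<in> N\<^sup>p\<close> the commutator \<open>e = [d, n]\<close>
is then central, and moving \<open>g\<close> past \<open>n\<^sup>p\<close> costs \<open>d\<^sup>p\<close> and \<open>e\<close> to the power \<open>p choose 2\<close>, both trivial
modulo \<open>K\<close>.
\<close>

lemma commutator_power_span_step:
  assumes G: "finite_p_group p G" "odd p" and N: "N \<lhd> G"
    and emb: "\<And>x g. x \<in> N \<Longrightarrow> g \<in> carrier G \<Longrightarrow> commutator G x g \<in> power_span G p N"
    and x: "x \<in> power_span G p N" and g: "g \<in> carrier G"
  shows "commutator G x g \<in> power_span G p (power_span G p N)"
proof -
  define P where "P = power_span G p N"
  define C where "C = {commutator G x g | x g. x \<in> P \<and> g \<in> carrier G}"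
  define A where "A = generate G C"
  interpret N: normal N G by (fact N)
  have PN: "P \<lhd> G" unfolding P_def by (rule power_span_normal[OF N])
  interpret P: normal P G by (fact PN)
  have B: "power_span G p P \<lhd> G" by (rule power_span_normal[OF PN])
  have prime: "Factorial_Ring.prime p" using G by (simp add: finite_p_group_def)
  have conj_comm: "g \<otimes> commutator G a b \<otimes> inv g = commutator G (g \<otimes> a \<otimes> inv g) (g \<otimes> b \<otimes> inv g)"
    if "g \<in> carrier G" "a \<in> carrier G" "b \<in> carrier G" for g a b
    using that by (simp add: commutator_def inv_mult_group m_assoc inv_mult_cancel)
  have A: "A \<lhd> G" unfolding A_def
  proof (rule normal_generateI)
    show "C \<subseteq> carrier G" using P.subset by (auto simp: C_def)
    fix h g assume "h \<in> C" and g: "g \<in> carrier G"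
    then obtain a b where ab: "a \<in> P" "b \<in> carrier G" "h = commutator G a b" by (auto simp: C_def)
    have "g \<otimes> h \<otimes> inv g = commutator G (g \<otimes> a \<otimes> inv g) (g \<otimes> b \<otimes> inv g)"
      unfolding ab(3) by (rule conj_comm[OF g P.mem_carrier[OF ab(1)] ab(2)])
    moreover have "g \<otimes> a \<otimes> inv g \<in> P" using P.inv_op_closed2[OF g ab(1)] .
    moreover have "g \<otimes> b \<otimes> inv g \<in> carrier G" using g ab by simp
    ultimately show "g \<otimes> h \<otimes> inv g \<in> C" unfolding C_def by blast
  qed
  have "A \<subseteq> power_span G p P"
  proof (rule normal_subset_by_central_layer[OF G(1) A B])
    fix K assume K: "K \<lhd> G" and BK: "power_span G p P \<subseteq> K" and AK: "A \<subseteq> central_layer G p K"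
    interpret K: normal K G by (fact K)
    from quotient_map[OF K] obtain Q :: "'a set monoid" and q where
      hom: "group_hom G Q q" and surj: "q ` carrier G = carrier Q"
      and q: "\<And>a. a \<in> carrier G \<Longrightarrow> q a = \<one>\<^bsub>Q\<^esub> \<longleftrightarrow> a \<in> K" by metis
    interpret q: group_hom G Q q by (fact hom)
    have CA: "C \<subseteq> A" unfolding A_def by (blast intro: generate.incl)
    have eqv: "q a \<otimes>\<^bsub>Q\<^esub> q b = q b \<otimes>\<^bsub>Q\<^esub> q a \<longleftrightarrow> commutator G a b \<in> K" if "a \<in> carrier G" "b \<in> carrier G" for a b
      using q[of "commutator G a b"] that by (simp add: q.hom_commutator q.H.commutator_eq_one_iff)
    have gen: "commutator G (n [^] p) g \<in> K" if n: "n \<in> N" and g: "g \<in> carrier G" for n g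
    proof -
      have nc: "n \<in> carrier G" using n by simp
      define d e where "d = commutator G n g" and "e = commutator G d n"
      have d: "d \<in> P" unfolding d_def P_def by (rule emb[OF n g])
      then have dc: "d \<in> carrier G" by simp
      have "e \<in> C" unfolding C_def e_def using d nc by blast
      then have e: "e \<in> central_layer G p K" using CA AK by blast
      then have ec: "e \<in> carrier G" by (rule central_layerD)
      have "q n \<otimes>\<^bsub>Q\<^esub> q g = q g \<otimes>\<^bsub>Q\<^esub> q n \<otimes>\<^bsub>Q\<^esub> q d"
        using q.H.commutator_swap[of "q n" "q g"] nc g by (simp add: d_def q.hom_commutator)
      moreover have "q d \<otimes>\<^bsub>Q\<^esub> q n = q n \<otimes>\<^bsub>Q\<^esub> q d \<otimes>\<^bsub>Q\<^esub> q e"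
        using q.H.commutator_swap[of "q d" "q n"] nc dc by (simp add: e_def q.hom_commutator)
      moreover have "q e \<otimes>\<^bsub>Q\<^esub> q n = q n \<otimes>\<^bsub>Q\<^esub> q e" "q e \<otimes>\<^bsub>Q\<^esub> q d = q d \<otimes>\<^bsub>Q\<^esub> q e"
        using eqv[OF ec nc] eqv[OF ec dc] central_layerD(3)[OF e] nc dc by simp_all
      ultimately have "q n [^]\<^bsub>Q\<^esub> p \<otimes>\<^bsub>Q\<^esub> q g
          = q g \<otimes>\<^bsub>Q\<^esub> q n [^]\<^bsub>Q\<^esub> p \<otimes>\<^bsub>Q\<^esub> q d [^]\<^bsub>Q\<^esub> p \<otimes>\<^bsub>Q\<^esub> q e [^]\<^bsub>Q\<^esub> (p choose 2)"
        using nc g dc ec by (intro q.H.pow_swap) auto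
      moreover have "q d [^]\<^bsub>Q\<^esub> p = \<one>\<^bsub>Q\<^esub>"
        using q[of "d [^] p"] dc power_span_mem[OF d, of p] BK by (auto simp: q.hom_nat_pow)
      moreover have "q e [^]\<^bsub>Q\<^esub> (p choose 2) = \<one>\<^bsub>Q\<^esub>"
        using q[of "e [^] (p choose 2)"] ec odd_prime_dvd_choose_two[OF prime G(2)]
          pow_dvd_mem[OF K.is_subgroup ec central_layerD(2)[OF e]] by (simp add: q.hom_nat_pow)
      ultimately have "q (n [^] p) \<otimes>\<^bsub>Q\<^esub> q g = q g \<otimes>\<^bsub>Q\<^esub> q (n [^] p)"
        using nc g by (simp add: q.hom_nat_pow)
      then show ?thesis using eqv[of "n [^] p" g] nc g by simp
    qed
    \<comment> \<open>with exponent 0 the layer is the whole preimage of the centre\<close>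
    have "P \<subseteq> central_layer G 0 K" unfolding P_def
    proof (rule power_span_least)
      show "subgroup (central_layer G 0 K) G"
        using central_layer_normal(1)[OF K] by (rule normal_imp_subgroup)
      show "n [^] p \<in> central_layer G 0 K" if "n \<in> N" for n
        using gen[OF that] that by (simp add: central_layer_def)
    qed
    then have "C \<subseteq> K" using central_layerD(3) by (fastforce simp: C_def)
    then show "A \<subseteq> K" unfolding A_def by (rule generate_subgroup_incl[OF _ K.is_subgroup])
  qed
  moreover have "commutator G x g \<in> A"
    unfolding A_def C_def P_def using x g by (blast intro: generate.incl)
  ultimately show ?thesis unfolding P_def by blast
qed

end

section \<open>Powerful groups\<close>

locale powerful_group = group G for G :: "('a, 'b) monoid_scheme" (structure) and p :: nat +
  assumes powerful: "powerful p G" and odd_p: "odd p"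
begin

definition power_series :: "nat \<Rightarrow> 'a set" where
  "power_series i = (power_span G p ^^ i) (carrier G)"

lemma power_series_0 [simp]: "power_series 0 = carrier G"
  and power_series_Suc [simp]: "power_series (Suc i) = power_span G p (power_series i)"
  by (simp_all add: power_series_def)

lemma p_group: "finite_p_group p G"
  using powerful by (simp add: powerful_def)

lemma prime_p: "Factorial_Ring.prime p"
  using p_group by (simp add: finite_p_group_def)

lemma power_series_normal: "power_series i \<lhd> G"
  by (induction i) (simp_all add: normal_self power_span_normal)

lemma power_series_carrier: "power_series i \<subseteq> carrier G"
  using power_series_normal normal_imp_subgroup subgroup.subset by blast

lemma power_series_decreasing: "power_series (Suc i) \<subseteq> power_series i"
  using power_span_subset[OF normal_imp_subgroup[OF power_series_normal]] by simp

lemma power_series_commutator: "x \<in> power_series i \<Longrightarrow> g \<in> carrier G \<Longrightarrow> commutator G x g \<in> power_series (Suc i)"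
proof (induction i arbitrary: x g)
  case 0
  then show ?case using powerful powerful_iff_commutators by simp
next
  case (Suc i)
  then show ?case
    using commutator_power_span_step[OF p_group odd_p power_series_normal[of i], of x g] by simp
qed

lemma power_series_central_layer: "power_series i \<subseteq> central_layer G p (power_series (Suc i))"
  using power_series_commutator power_series_carrier power_span_mem by (fastforce simp: central_layer_def)

text \<open>
If the series stops at a term \<open>A\<close>, then \<open>A = A\<^sup>p\<close>; but modulo any \<open>K\<close> for which \<open>A\<close> has exponent \<open>p\<close> the
subgroup \<open>A\<^sup>p\<close> is trivial.
\<close>

lemma power_series_stationary:
  assumes "power_series (Suc i) = power_series i"
  shows "power_series i = {\<one>}"
proof -
  have "power_series i \<subseteq> {\<one>}"
  proof (rule normal_subset_by_central_layer[OF p_group power_series_normal one_is_normal])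
    fix K assume K: "K \<lhd> G" and sub: "power_series i \<subseteq> central_layer G p K"
    have "power_series (Suc i) \<subseteq> K"
      unfolding power_series_Suc using normal_imp_subgroup[OF K] central_layerD(2) sub
      by (intro power_span_least) auto
    then show "power_series i \<subseteq> K" using assms by simp
  qed
  moreover have "\<one> \<in> power_series i" using normal_imp_subgroup[OF power_series_normal] by (rule subgroup.one_closed)
  ultimately show ?thesis by blast
qed

lemma power_series_eventually_trivial: "\<exists>k. power_series k = {\<one>}"
proof -
  obtain k where k: "\<And>j. card (power_series k) \<le> card (power_series j)"
    using exists_least_iff[of "\<lambda>n. \<exists>k. card (power_series k) = n"] by (metis linorder_not_less)
  have "finite (power_series k)" using finite_subset[OF power_series_carrier] p_group by (simp add: finite_p_group_def)
  then have "power_series (Suc k) = power_series k" using power_series_decreasing[of k] k[of "Suc k"] by (metis card_seteq)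
  then show ?thesis using power_series_stationary by blast
qed

text \<open>
The commutator \<open>[z, x]\<close> is one step below \<open>z\<close>, and the next step contains its \<open>p\<close>-th power and all its
commutators.
\<close>

lemma pow_mult_mod_power_series:
  assumes "x \<in> carrier G" "z \<in> power_series i"
  shows "\<exists>t \<in> power_series (Suc (Suc i)). (x \<otimes> z) [^] p = x [^] p \<otimes> z [^] p \<otimes> t"
  using assms power_series_carrier power_series_commutator[of z i x] power_series_central_layer[of "Suc i"]
  by (intro pow_mult_mod_central[OF power_series_normal prime_p odd_p]) blast+

lemma power_series_Suc_elements:
  assumes "y \<in> power_series (Suc i)"
  shows "\<exists>z \<in> power_series i. \<exists>t \<in> power_series (Suc (Suc i)). y = z [^] p \<otimes> t"
proof -
  interpret N: normal "power_series (Suc (Suc i))" G by (rule power_series_normal)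
  interpret Pi: normal "power_series i" G by (rule power_series_normal)
  have "y \<in> generate G ((\<lambda>x. x [^] p) ` power_series i)" using assms by (simp add: power_span_def)
  then show ?thesis
  proof (induction y rule: generate.induct)
    case one
    have "\<one> = \<one> [^] p \<otimes> \<one>" by simp
    then show ?case using Pi.one_closed N.one_closed by blast
  next
    case (incl h)
    then obtain z where z: "z \<in> power_series i" "h = z [^] p" by blast
    then have "h = z [^] p \<otimes> \<one>" using Pi.mem_carrier[OF z(1)] by simp
    then show ?case using z N.one_closed by blast
  next
    case (inv h)
    then obtain z where z: "z \<in> power_series i" "h = z [^] p" by blast
    then have "inv h = (inv z) [^] p \<otimes> \<one>" using Pi.mem_carrier[OF z(1)] by (simp add: nat_pow_inv)
    then show ?case using Pi.m_inv_closed[OF z(1)] N.one_closed by blast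
  next
    case (eng h1 h2)
    then obtain z1 t1 z2 t2 where z1: "z1 \<in> power_series i" and t1: "t1 \<in> power_series (Suc (Suc i))"
      and h1: "h1 = z1 [^] p \<otimes> t1" and z2: "z2 \<in> power_series i" and t2: "t2 \<in> power_series (Suc (Suc i))"
      and h2: "h2 = z2 [^] p \<otimes> t2" by blast
    have c: "z1 \<in> carrier G" "z2 \<in> carrier G" "t1 \<in> carrier G" "t2 \<in> carrier G"
      using Pi.mem_carrier[OF z1] Pi.mem_carrier[OF z2] N.mem_carrier[OF t1] N.mem_carrier[OF t2] by auto
    obtain s where s: "s \<in> power_series (Suc (Suc i))" "(z1 \<otimes> z2) [^] p = z1 [^] p \<otimes> z2 [^] p \<otimes> s"
      using pow_mult_mod_power_series[OF c(1) z2] by blast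
    have sc: "s \<in> carrier G" by (rule N.mem_carrier[OF s(1)])
    define r where "r = inv (z2 [^] p) \<otimes> t1 \<otimes> z2 [^] p"
    have r: "r \<in> power_series (Suc (Suc i))" unfolding r_def using c t1 by (intro N.inv_op_closed1) auto
    have rc: "r \<in> carrier G" by (rule N.mem_carrier[OF r])
    have "h1 \<otimes> h2 = (z1 \<otimes> z2) [^] p \<otimes> (inv s \<otimes> (r \<otimes> t2))"
      unfolding h1 h2 s(2) r_def using c sc by (simp add: m_assoc inv_mult_cancel)
    moreover have "inv s \<otimes> (r \<otimes> t2) \<in> power_series (Suc (Suc i))"
      by (intro N.m_closed N.m_inv_closed s(1) r t2)
    moreover have "z1 \<otimes> z2 \<in> power_series i" using Pi.m_closed[OF z1 z2] .
    ultimately show ?case by blast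
  qed
qed

text \<open>
Newton-like approximation: an error \<open>y\<close> in a term of the series is a \<open>p\<close>-th power \<open>z\<^sup>p\<close> up to the following
term, and \<open>x\<^sup>p z\<^sup>p\<close> may be replaced by \<open>(xz)\<^sup>p\<close> at a cost of the same order.
\<close>

lemma power_approximation:
  assumes "g \<in> power_series 1"
  shows "\<exists>x \<in> carrier G. \<exists>y \<in> power_series (Suc k). g = x [^] p \<otimes> y"
proof (induction k)
  case 0
  have "g \<in> carrier G" using assms power_series_carrier by blast
  then have "g = \<one> [^] p \<otimes> g" by simp
  then show ?case using assms by (metis One_nat_def one_closed)
next
  case (Suc k)
  then obtain x y where x: "x \<in> carrier G" and y: "y \<in> power_series (Suc k)" and g: "g = x [^] p \<otimes> y" by blast
  obtain z t where z: "z \<in> power_series k" and t: "t \<in> power_series (Suc (Suc k))" and yz: "y = z [^] p \<otimes> t"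
    using power_series_Suc_elements[OF y] by blast
  obtain s where s: "s \<in> power_series (Suc (Suc k))" "(x \<otimes> z) [^] p = x [^] p \<otimes> z [^] p \<otimes> s"
    using pow_mult_mod_power_series[OF x z] by blast
  interpret N: normal "power_series (Suc (Suc k))" G by (rule power_series_normal)
  have c: "z \<in> carrier G" "t \<in> carrier G" "s \<in> carrier G" using z t s power_series_carrier by blast+
  have "g = (x \<otimes> z) [^] p \<otimes> (inv s \<otimes> t)"
    unfolding g yz s(2) using x c by (simp add: m_assoc inv_mult_cancel)
  moreover have "inv s \<otimes> t \<in> power_series (Suc (Suc k))" by (intro N.m_closed N.m_inv_closed s(1) t)
  ultimately show ?case using x c by blast
qed

theorem power_span_eq_powers:
  assumes "g \<in> power_span G p (carrier G)"
  shows "\<exists>x \<in> carrier G. g = x [^] p"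
proof -
  obtain k where "power_series k = {\<one>}" using power_series_eventually_trivial by blast
  then have "power_series (Suc k) \<subseteq> {\<one>}" using power_series_decreasing by blast
  moreover obtain x y where "x \<in> carrier G" "y \<in> power_series (Suc k)" "g = x [^] p \<otimes> y"
    using power_approximation[of g k] assms by auto
  ultimately have "x \<in> carrier G" "g = x [^] p" by auto
  then show ?thesis by blast
qed

end

context group
begin

text \<open>
The facts about powerful groups that are used for maximal subgroups, expressed inside the ambient group.
\<close>

lemma powerful_subgroupD:
  assumes M: "subgroup M G" and pow: "powerful p (G\<lparr>carrier := M\<rparr>)" and "odd p"
  shows "g \<in> power_span G p M \<Longrightarrow> \<exists>x \<in> M. g = x [^] p"
    and "x \<in> M \<Longrightarrow> y \<in> M \<Longrightarrow> commutator G x y \<in> power_span G p M"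
    and "x \<in> power_span G p M \<Longrightarrow> y \<in> M \<Longrightarrow> commutator G x y \<in> power_span G p (power_span G p M)"
    and "x \<in> M \<Longrightarrow> y \<in> M \<Longrightarrow>
      \<exists>k \<in> power_span G p (power_span G p M). (x \<otimes> y) [^] p = x [^] p \<otimes> y [^] p \<otimes> k"
proof -
  interpret H: powerful_group "G\<lparr>carrier := M\<rparr>" p
    using subgroup_imp_group[OF M] assms by (simp add: powerful_group_def powerful_group_axioms_def)
  have P1: "H.power_series 1 = power_span G p M" using power_span_consistent[OF M, of M] by simp
  have sub: "power_span G p M \<subseteq> M" by (rule power_span_subset[OF M])
  have P2: "H.power_series 2 = power_span G p (power_span G p M)"
    using P1 power_span_consistent[OF M sub] by (simp add: numeral_2_eq_2)
  show "\<exists>x \<in> M. g = x [^] p" if "g \<in> power_span G p M" for g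
    using H.power_span_eq_powers[of g] that P1 by (simp flip: nat_pow_consistent)
  show "commutator G x y \<in> power_span G p M" if "x \<in> M" "y \<in> M" for x y
    using H.power_series_commutator[of x 0 y] that P1 commutator_consistent[OF M that] by simp
  show "commutator G x y \<in> power_span G p (power_span G p M)"
    if "x \<in> power_span G p M" "y \<in> M" for x y
  proof -
    have "x \<in> M" using that sub by blast
    then show ?thesis
      using H.power_series_commutator[of x 1 y] that P1 P2 commutator_consistent[OF M, of x y]
      by (simp add: numeral_2_eq_2)
  qed
  show "\<exists>k \<in> power_span G p (power_span G p M). (x \<otimes> y) [^] p = x [^] p \<otimes> y [^] p \<otimes> k"
    if "x \<in> M" "y \<in> M" for x y
    using H.pow_mult_mod_power_series[of x y 0] that P2 by (simp add: numeral_2_eq_2 flip: nat_pow_consistent)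
qed

text \<open>
If \<open>G\<^sup>p\<close> consists of \<open>p\<close>-th powers, a property of \<open>p\<^sup>i\<close>-th powers in \<open>G\<^sup>p\<close> is one of \<open>p\<^sup>i\<^sup>+\<^sup>1\<close>-th powers in \<open>G\<close>.
\<close>

lemma pow_mult_closed_step:
  assumes roots: "\<And>g. g \<in> power_span G p (carrier G) \<Longrightarrow> \<exists>x \<in> carrier G. g = x [^] p"
    and mult: "\<And>x y. x \<in> power_span G p (carrier G) \<Longrightarrow> y \<in> power_span G p (carrier G) \<Longrightarrow>
      \<exists>z \<in> power_span G p (carrier G). x [^] (p ^ i) \<otimes> y [^] (p ^ i) = z [^] (p ^ i)"
    and xy: "x \<in> carrier G" "y \<in> carrier G"
  shows "\<exists>z \<in> carrier G. x [^] (p ^ Suc i) \<otimes> y [^] (p ^ Suc i) = z [^] (p ^ Suc i)"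
proof -
  have pp: "(a [^] p) [^] (p ^ i) = a [^] (p ^ Suc i)" if "a \<in> carrier G" for a
    using that by (simp add: nat_pow_pow)
  obtain z where z: "z \<in> power_span G p (carrier G)"
    "(x [^] p) [^] (p ^ i) \<otimes> (y [^] p) [^] (p ^ i) = z [^] (p ^ i)"
    using mult[OF power_span_mem[OF xy(1)] power_span_mem[OF xy(2)]] by blast
  obtain w where w: "w \<in> carrier G" "z = w [^] p" using roots[OF z(1)] by blast
  then show ?thesis using z(2) pp[OF xy(1)] pp[OF xy(2)] pp[OF w(1)] by auto
qed

end

theorem powerful_pow_mult_closed:
  assumes "powerful p G" "odd p" "x \<in> carrier G" "y \<in> carrier G"
  shows "\<exists>z \<in> carrier G. x [^]\<^bsub>G\<^esub> (p ^ i) \<otimes>\<^bsub>G\<^esub> y [^]\<^bsub>G\<^esub> (p ^ i) = z [^]\<^bsub>G\<^esub> (p ^ i)"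
  using assms
proof (induction i arbitrary: G x y)
  case 0
  then interpret G: group G by (simp add: powerful_def finite_p_group_def)
  show ?case using 0 by (auto intro!: bexI[of _ "x \<otimes>\<^bsub>G\<^esub> y"])
next
  case (Suc i)
  then interpret G: powerful_group G p
    by (simp add: powerful_group_def powerful_group_axioms_def powerful_def finite_p_group_def)
  define S where "S = power_span G p (carrier G)"
  have S: "subgroup S G" unfolding S_def by (rule G.power_span_subgroup) simp
  have "powerful p (G\<lparr>carrier := S\<rparr>)"
  proof -
    have gS: "group (G\<lparr>carrier := S\<rparr>)" by (rule G.subgroup_imp_group[OF S])
    have "commutator G x y \<in> power_span G p S" if "x \<in> S" "y \<in> S" for x y
      using G.power_series_commutator[of x 1 y] that subgroup.mem_carrier[OF S] by (simp add: S_def)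
    then show ?thesis
      unfolding group.powerful_iff_commutators[OF gS]
      using finite_p_group_subgroup[OF G.p_group S]
      by (simp add: G.power_span_consistent[OF S] G.commutator_consistent[OF S])
  qed
  then have "\<exists>z \<in> S. x [^]\<^bsub>G\<^esub> (p ^ i) \<otimes>\<^bsub>G\<^esub> y [^]\<^bsub>G\<^esub> (p ^ i) = z [^]\<^bsub>G\<^esub> (p ^ i)"
    if "x \<in> S" "y \<in> S" for x y
    using Suc.IH[of "G\<lparr>carrier := S\<rparr>" x y] that Suc.prems(2)
    by (simp flip: G.nat_pow_consistent)
  then show ?case
    using G.pow_mult_closed_step[OF G.power_span_eq_powers _ Suc.prems(3,4)] unfolding S_def by blast
qed

section \<open>Groups whose maximal subgroups are powerful\<close>

context group
begin

lemma power_span_eq_if_pow_mult_closed: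
  assumes "\<And>x y. x \<in> carrier G \<Longrightarrow> y \<in> carrier G \<Longrightarrow> \<exists>z \<in> carrier G. x [^] n \<otimes> y [^] n = z [^] (n::nat)"
  shows "power_span G n (carrier G) = {g [^] n | g. g \<in> carrier G}"
proof
  show "{g [^] n | g. g \<in> carrier G} \<subseteq> power_span G n (carrier G)"
    using power_span_mem by blast
  have "h \<in> {g [^] n | g. g \<in> carrier G}" if "h \<in> generate G ((\<lambda>x. x [^] n) ` carrier G)" for h
    using that
  proof (induction h rule: generate.induct)
    case one
    have "\<one> = \<one> [^] n" by simp
    then show ?case by blast
  next
    case (inv h)
    then obtain g where "g \<in> carrier G" "h = g [^] n" by blast
    then have "inv h = (inv g) [^] n" "inv g \<in> carrier G" by (simp_all add: nat_pow_inv)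
    then show ?case by blast
  next
    case (eng h1 h2)
    then show ?case using assms by blast
  qed blast
  then show "power_span G n (carrier G) \<subseteq> {g [^] n | g. g \<in> carrier G}"
    unfolding power_span_def by blast
qed

lemma commuting_mod_subgroup:
  assumes K: "K \<lhd> G" and b: "b \<in> carrier G"
  shows "subgroup {a \<in> carrier G. commutator G a b \<in> K} G"
proof -
  from quotient_map[OF K] obtain Q :: "'a set monoid" and q where
    hom: "group_hom G Q q" and q: "\<And>a. a \<in> carrier G \<Longrightarrow> q a = \<one>\<^bsub>Q\<^esub> \<longleftrightarrow> a \<in> K" by metis
  interpret q: group_hom G Q q by (fact hom)
  define Z where "Z = {v \<in> carrier Q. v \<otimes>\<^bsub>Q\<^esub> q b = q b \<otimes>\<^bsub>Q\<^esub> v}"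
  have qb: "q b \<in> carrier Q" using b by simp
  have "subgroup Z Q"
  proof (rule subgroup.intro)
    fix v w assume v: "v \<in> Z" and w: "w \<in> Z"
    show "v \<otimes>\<^bsub>Q\<^esub> w \<in> Z"
      using v w q.H.commute_mult_right[of "q b" v w] qb by (simp add: Z_def)
  next
    fix v assume v: "v \<in> Z"
    then have c: "v \<in> carrier Q" "v \<otimes>\<^bsub>Q\<^esub> q b = q b \<otimes>\<^bsub>Q\<^esub> v" by (simp_all add: Z_def)
    have "inv\<^bsub>Q\<^esub> v \<otimes>\<^bsub>Q\<^esub> q b = inv\<^bsub>Q\<^esub> v \<otimes>\<^bsub>Q\<^esub> (q b \<otimes>\<^bsub>Q\<^esub> v) \<otimes>\<^bsub>Q\<^esub> inv\<^bsub>Q\<^esub> v"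
      using c(1) qb by (simp add: q.H.m_assoc)
    also have "\<dots> = q b \<otimes>\<^bsub>Q\<^esub> inv\<^bsub>Q\<^esub> v"
      unfolding c(2)[symmetric] using c(1) qb by (simp add: q.H.inv_mult_cancel)
    finally show "inv\<^bsub>Q\<^esub> v \<in> Z" using c(1) by (simp add: Z_def)
  qed (use qb in \<open>auto simp: Z_def\<close>)
  then have "subgroup {a \<in> carrier G. q a \<in> Z} G" by (rule q.subgroup_preimage)
  moreover have "q a \<in> Z \<longleftrightarrow> commutator G a b \<in> K" if "a \<in> carrier G" for a
    using that b q[of "commutator G a b"]
    by (simp add: Z_def q.hom_commutator q.H.commutator_eq_one_iff)
  ultimately show ?thesis by (metis (no_types, lifting) Collect_cong)
qed

lemma commutator_mem_sym:
  assumes "subgroup K G" "a \<in> carrier G" "b \<in> carrier G" "commutator G a b \<in> K"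
  shows "commutator G b a \<in> K"
proof -
  have "inv (commutator G a b) = commutator G b a"
    using assms by (simp add: commutator_def inv_mult_group m_assoc)
  then show ?thesis using subgroup.m_inv_closed[OF assms(1,4)] by simp
qed

lemma commutator_mult_right:
  assumes "c \<in> carrier G" "x \<in> carrier G" "y \<in> carrier G"
  shows "commutator G c (x \<otimes> y) =
    commutator G c y \<otimes> commutator G c x \<otimes> commutator G (commutator G c x) y"
  using assms by (simp add: commutator_def inv_mult_group m_assoc inv_mult_cancel)

lemma mem_subgroup_cancel_right:
  assumes "subgroup H G" "a \<in> carrier G" "k \<in> H" "a \<otimes> k \<in> H"
  shows "a \<in> H"
proof -
  have "a = (a \<otimes> k) \<otimes> inv k" using assms subgroup.mem_carrier[OF assms(1,3)] by (simp add: m_assoc)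
  then show ?thesis using subgroup.m_closed[OF assms(1,4) subgroup.m_inv_closed[OF assms(1,3)]] by simp
qed

lemma mem_subgroup_cancel_left:
  assumes "subgroup H G" "a \<in> carrier G" "k \<in> H" "k \<otimes> a \<in> H"
  shows "a \<in> H"
proof -
  have "a = inv k \<otimes> (k \<otimes> a)" using assms subgroup.mem_carrier[OF assms(1,3)] by (simp add: inv_mult_cancel)
  then show ?thesis using subgroup.m_closed[OF assms(1) subgroup.m_inv_closed[OF assms(1,3)] assms(4)] by simp
qed

text \<open>
Write \<open>x\<close> and \<open>y\<close> additively, as the standard generators of a plane over the field of three elements. The two
given members of \<open>T\<close> are \<open>(1 + i, 1 + 2j)\<close> and \<open>(i, j)\<close>, and \<open>(1, 1)\<close> is a linear combination of them except when
\<open>i = 2\<close> and \<open>j = 1\<close>. In that case the first vector vanishes, hence so does the second one, \<open>(2, 1)\<close>,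
which means \<open>x = y\<close>.
\<close>

lemma exponent_three_mem_or_eq:
  fixes i j :: nat
  assumes x: "x \<in> carrier G" "x [^] (3::nat) = \<one>" and y: "y \<in> carrier G" "y [^] (3::nat) = \<one>"
    and xy: "x \<otimes> y = y \<otimes> x" and T: "subgroup T G"
    and W: "x \<otimes> y \<otimes> x [^] i \<otimes> (y [^] j) [^] (2::nat) \<in> T"
    and Z: "y [^] j \<otimes> x [^] i \<in> T"
    and triv: "x \<otimes> y \<otimes> x [^] i \<otimes> (y [^] j) [^] (2::nat) = \<one> \<Longrightarrow> T \<subseteq> {\<one>}"
  shows "x \<otimes> y \<in> T \<or> x = y"
proof -
  define f where "f a b = x [^] a \<otimes> y [^] b" for a b :: nat
  have red: "a [^] n = a [^] (n mod 3)" if "a \<in> carrier G" "a [^] (3::nat) = \<one>" for a and n :: nat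
  proof -
    have "a [^] n = a [^] (3 * (n div 3) + n mod 3)" by simp
    also have "\<dots> = (a [^] (3::nat)) [^] (n div 3) \<otimes> a [^] (n mod 3)"
      using that(1) by (simp add: nat_pow_pow nat_pow_mult)
    finally show ?thesis using that by simp
  qed
  have f_cong: "f a b = f c d" if "a mod 3 = c mod 3" "b mod 3 = d mod 3" for a b c d
    unfolding f_def using that red[OF x, of a] red[OF x, of c] red[OF y, of b] red[OF y, of d] by simp
  have comm: "y [^] b \<otimes> x [^] a = x [^] a \<otimes> y [^] b" for a b :: nat
    using commute_pow[of "y [^] b" x a] commute_pow[of x y b] x(1) y(1) xy by simp
  have f_mult: "f a b \<otimes> f c d = f (a + c) (b + d)" for a b c d
  proof -
    have "f a b \<otimes> f c d = x [^] a \<otimes> (y [^] b \<otimes> x [^] c) \<otimes> y [^] d"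
      using x(1) y(1) by (simp add: f_def m_assoc)
    also have "\<dots> = (x [^] a \<otimes> x [^] c) \<otimes> (y [^] b \<otimes> y [^] d)"
      unfolding comm using x(1) y(1) by (simp add: m_assoc)
    finally show ?thesis using x(1) y(1) by (simp add: f_def nat_pow_mult)
  qed
  have "x \<otimes> y \<otimes> x [^] i \<otimes> (y [^] j) [^] (2::nat) = f 1 1 \<otimes> (f i 0 \<otimes> f 0 (j * 2))"
    using x(1) y(1) by (simp add: f_def m_assoc nat_pow_pow)
  also have "\<dots> = f (1 + i) (1 + 2 * j)" by (simp add: f_mult mult.commute)
  finally have W_eq: "x \<otimes> y \<otimes> x [^] i \<otimes> (y [^] j) [^] (2::nat) = f (1 + i) (1 + 2 * j)" .
  then have W': "f (1 + i) (1 + 2 * j) \<in> T" using W by simp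
  have Z': "f i j \<in> T" using Z comm by (simp add: f_def)
  have combo: "f (a * (1 + i) + b * i) (a * (1 + 2 * j) + b * j) \<in> T" for a b :: nat
  proof -
    have pw: "f c d [^] n = f (n * c) (n * d)" for c d n
      by (induction n) (use x(1) y(1) in \<open>simp_all add: f_mult add.commute\<close>, simp add: f_def)
    have "f (1 + i) (1 + 2 * j) [^] a \<otimes> f i j [^] b \<in> T"
      by (intro subgroup.m_closed[OF T] subgroup_pow_closed[OF T] W' Z')
    then show ?thesis by (simp only: pw f_mult)
  qed
  have xyf: "x \<otimes> y = f 1 1" using x(1) y(1) by (simp add: f_def)
  have by_combo: "x \<otimes> y \<in> T"
    if "(a * (1 + i) + b * i) mod 3 = 1" "(a * (1 + 2 * j) + b * j) mod 3 = 1" for a b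
    using combo[of a b] f_cong[of "a * (1 + i) + b * i" 1 "a * (1 + 2 * j) + b * j" 1] that xyf by simp
  consider "i mod 3 = 0" | "j mod 3 = 0" | "i mod 3 = 1" "j mod 3 = 1" | "i mod 3 = 1" "j mod 3 = 2"
    | "i mod 3 = 2" "j mod 3 = 2" | "i mod 3 = 2" "j mod 3 = 1"
    by linarith
  then show ?thesis
  proof cases
    case 1
    then have "x \<otimes> y \<in> T" by (intro by_combo[of 1 1]) presburger+
    then show ?thesis ..
  next
    case 2
    then have "x \<otimes> y \<in> T" by (intro by_combo[of 1 2]) presburger+
    then show ?thesis ..
  next
    case 3
    then have "x \<otimes> y \<in> T" by (intro by_combo[of 0 1]) presburger+
    then show ?thesis ..
  next
    case 4
    then have "x \<otimes> y \<in> T" by (intro by_combo[of 2 0]) presburger+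
    then show ?thesis ..
  next
    case 5
    then have "x \<otimes> y \<in> T" by (intro by_combo[of 0 2]) presburger+
    then show ?thesis ..
  next
    case 6
    have "(1 + i) mod 3 = 0 mod 3" "(1 + 2 * j) mod 3 = 0 mod 3" using 6 by presburger+
    then have "f (1 + i) (1 + 2 * j) = f 0 0" by (rule f_cong)
    then have "T \<subseteq> {\<one>}" using triv W_eq by (simp add: f_def)
    then have "f i j = \<one>" using Z' by blast
    moreover have "f i j = f 2 1" using 6 by (intro f_cong) simp_all
    ultimately have "f 2 1 = \<one>" by simp
    then have "x = f 1 0 \<otimes> f 2 1" using x(1) by (simp add: f_def)
    also have "\<dots> = f 0 1" unfolding f_mult by (rule f_cong) simp_all
    also have "\<dots> = y" using y(1) by (simp add: f_def)
    finally show ?thesis ..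
  qed
qed

end

locale m1_group = group G for G :: "('a, 'b) monoid_scheme" (structure) and p :: nat +
  assumes m1: "M1_p_group p G" and odd_p: "odd p"
begin

lemma p_group: "finite_p_group p G"
  using m1 by (simp add: M1_p_group_def)

lemma finite_carrier: "finite (carrier G)"
  using p_group by (simp add: finite_p_group_def)

lemma prime_p: "Factorial_Ring.prime p"
  using p_group by (simp add: finite_p_group_def)

lemma maximal_subgroup_imp_subgroup: "maximal_subgroup M G \<Longrightarrow> subgroup M G"
  by (simp add: maximal_subgroup_def)

lemmas maximal_normal = maximal_subgroup_contains(1)[OF p_group]
  and pow_mem_maximal = maximal_subgroup_contains(2)[OF p_group]
  and commutator_mem_maximal = maximal_subgroup_contains(3)[OF p_group]

lemma maximal_powerful:
  assumes "maximal_subgroup M G"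
  shows "powerful p (G\<lparr>carrier := M\<rparr>)"
  using assms m1 by (simp add: M1_p_group_def)

lemma maximal_facts:
  assumes "maximal_subgroup M G"
  shows "g \<in> power_span G p M \<Longrightarrow> \<exists>x \<in> M. g = x [^] p"
    and "x \<in> M \<Longrightarrow> y \<in> M \<Longrightarrow> commutator G x y \<in> power_span G p M"
    and "x \<in> power_span G p M \<Longrightarrow> y \<in> M \<Longrightarrow> commutator G x y \<in> power_span G p (power_span G p M)"
    and "x \<in> M \<Longrightarrow> y \<in> M \<Longrightarrow>
      \<exists>k \<in> power_span G p (power_span G p M). (x \<otimes> y) [^] p = x [^] p \<otimes> y [^] p \<otimes> k"
  by (fact powerful_subgroupD[OF maximal_subgroup_imp_subgroup[OF assms] maximal_powerful[OF assms] odd_p])+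

text \<open>
If \<open>x\<close> lies in the maximal subgroup \<open>M\<close>, then \<open>[x\<^sup>p, y\<^sup>p] \<in> [M\<^sup>p, M] \<subseteq> (M\<^sup>p)\<^sup>p\<close>. So the generators of \<open>G\<^sup>p\<close>
commute modulo \<open>(G\<^sup>p)\<^sup>p\<close>, and therefore all its elements do.
\<close>

lemma power_span_powerful:
  assumes cover: "\<And>x. x \<in> carrier G \<Longrightarrow> \<exists>M. maximal_subgroup M G \<and> x \<in> M"
  shows "powerful p (G\<lparr>carrier := power_span G p (carrier G)\<rparr>)"
proof -
  define S B where "S = power_span G p (carrier G)" and "B = power_span G p S"
  have SN: "S \<lhd> G" unfolding S_def by (rule power_span_normal[OF normal_self])
  have S: "subgroup S G" using SN by (rule normal_imp_subgroup)
  have BN: "B \<lhd> G" unfolding B_def by (rule power_span_normal[OF SN])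
  have B: "subgroup B G" using BN by (rule normal_imp_subgroup)
  have gens: "commutator G (x [^] p) (y [^] p) \<in> B" if "x \<in> carrier G" "y \<in> carrier G" for x y
  proof -
    obtain M where M: "maximal_subgroup M G" "x \<in> M" using cover[OF \<open>x \<in> carrier G\<close>] by blast
    have "M \<subseteq> carrier G" using maximal_subgroup_imp_subgroup[OF M(1)] by (rule subgroup.subset)
    then have "power_span G p (power_span G p M) \<subseteq> B"
      unfolding B_def S_def by (intro power_span_mono)
    moreover have "commutator G (x [^] p) (y [^] p) \<in> power_span G p (power_span G p M)"
      using M that by (intro maximal_facts(3) power_span_mem pow_mem_maximal)
    ultimately show ?thesis by blast
  qed
  have left: "commutator G a (y [^] p) \<in> B" if "a \<in> S" "y \<in> carrier G" for a y
  proof -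
    have "S \<subseteq> {a \<in> carrier G. commutator G a (y [^] p) \<in> B}"
      unfolding S_def using gens that commuting_mod_subgroup[OF BN]
      by (intro power_span_least) auto
    then show ?thesis using that by blast
  qed
  have "commutator G a b \<in> B" if a: "a \<in> S" and b: "b \<in> S" for a b
  proof -
    have ac: "a \<in> carrier G" using subgroup.mem_carrier[OF S a] .
    have "S \<subseteq> {b \<in> carrier G. commutator G b a \<in> B}"
      unfolding S_def using left[OF a] commuting_mod_subgroup[OF BN ac] commutator_mem_sym[OF B ac]
      by (intro power_span_least) auto
    then show ?thesis using commutator_mem_sym[OF B _ ac] b by blast
  qed
  moreover have gS: "group (G\<lparr>carrier := S\<rparr>)" by (rule subgroup_imp_group[OF S])
  ultimately have "powerful p (G\<lparr>carrier := S\<rparr>)"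
    unfolding group.powerful_iff_commutators[OF gS] B_def
    using finite_p_group_subgroup[OF p_group S]
    by (simp add: power_span_consistent[OF S] commutator_consistent[OF S])
  then show ?thesis by (simp add: S_def)
qed

text \<open>
The subgroup \<open>S\<^sup>p\<close> is generated modulo \<open>K = F\<^sup>p\<close> by \<open>w\<^sup>p\<close>, whose \<open>p\<close>-th power is in \<open>K\<close>. So \<open>S\<^sup>p K/K\<close> is a
normal subgroup of order at most \<open>p\<close> in a \<open>p\<close>-group, and such a subgroup is central.
\<close>

lemma maximal_cyclic_extension:
  assumes S: "maximal_subgroup S G" and F: "F \<lhd> G" "F \<subseteq> S" and w: "w \<in> S"
    and pF: "\<forall>g \<in> carrier G. g [^] p \<in> F"
    and gen: "\<forall>s \<in> S. \<exists>i::nat. \<exists>f \<in> F. s = w [^] i \<otimes> f"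
  defines "K \<equiv> power_span G p F"
  shows "a \<in> power_span G p S \<Longrightarrow> \<exists>i::nat. \<exists>k \<in> K. a = (w [^] p) [^] i \<otimes> k"
    and "power_span G p S \<subseteq> central_layer G p K"
    and "K \<subseteq> power_span G p S"
proof -
  have Ssub: "subgroup S G" by (rule maximal_subgroup_imp_subgroup[OF S])
  have SN: "S \<lhd> G" by (rule maximal_normal[OF S])
  have KN: "K \<lhd> G" unfolding K_def by (rule power_span_normal[OF F(1)])
  interpret S: subgroup S G by (fact Ssub)
  interpret F: normal F G by (fact F(1))
  interpret K: normal K G by (fact KN)
  have wc: "w \<in> carrier G" using w by simp
  define A where "A = power_span G p S"
  have AN: "A \<lhd> G" unfolding A_def by (rule power_span_normal[OF SN])
  interpret A: normal A G by (fact AN)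
  have AF: "A \<subseteq> F" unfolding A_def using pF by (intro power_span_least F.is_subgroup) auto
  have AAK: "power_span G p A \<subseteq> K" unfolding K_def by (rule power_span_mono[OF AF])
  have wpA: "w [^] p \<in> A" unfolding A_def by (rule power_span_mem[OF w])
  have wppK: "(w [^] p) [^] p \<in> K" using power_span_mem[OF wpA] AAK by blast
  show form: "\<exists>i::nat. \<exists>k \<in> K. a = (w [^] p) [^] i \<otimes> k" if a: "a \<in> power_span G p S" for a
  proof -
    obtain s where s: "s \<in> S" "a = s [^] p" using maximal_facts(1)[OF S a] by blast
    obtain i :: nat and f where f: "f \<in> F" "s = w [^] i \<otimes> f" using gen s(1) by blast
    have fc: "f \<in> carrier G" using f by simp
    have "w [^] i \<in> S" by (rule subgroup_pow_closed[OF Ssub w])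
    moreover have "f \<in> S" using f F(2) by blast
    ultimately obtain k where k: "k \<in> power_span G p (power_span G p S)"
      "(w [^] i \<otimes> f) [^] p = (w [^] i) [^] p \<otimes> f [^] p \<otimes> k"
      using maximal_facts(4)[OF S] by blast
    have kK: "k \<in> K" using k(1) AAK unfolding A_def by blast
    have "f [^] p \<in> K" unfolding K_def by (rule power_span_mem[OF f(1)])
    then have "f [^] p \<otimes> k \<in> K" using kK by (rule K.m_closed)
    moreover have "a = (w [^] p) [^] i \<otimes> (f [^] p \<otimes> k)"
      unfolding s(2) f(2) k(2) using wc fc K.mem_carrier[OF kK]
      by (simp add: m_assoc nat_pow_pow mult.commute)
    ultimately show ?thesis by blast
  qed
  have pow_comm: "commutator G (w [^] p) g \<in> K" if g: "g \<in> carrier G" for g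
  proof -
    define d where "d = commutator G (w [^] p) g"
    have "d \<in> A" unfolding d_def by (rule commutator_mem_normal_left[OF AN wpA g])
    then obtain i :: nat and k where k: "k \<in> K" "d = (w [^] p) [^] i \<otimes> k"
      using form unfolding A_def by blast
    show ?thesis
    proof (cases "p dvd i")
      case True
      then have "(w [^] p) [^] i \<in> K" using wc by (intro pow_dvd_mem[OF K.is_subgroup _ wppK]) auto
      then show ?thesis using k(2) K.m_closed[OF _ k(1)] by (simp add: d_def)
    next
      case False
      \<comment> \<open>\<open>d\<close> generates \<open>A\<close> modulo \<open>K\<close>; so as soon as \<open>[A, G]\<close> is trivial, \<open>A\<close> is trivial too\<close>
      have "A \<subseteq> K"
      proof (rule normal_subset_by_central_layer[OF p_group AN KN])
        fix L assume L: "L \<lhd> G" and KL: "K \<subseteq> L" and AL: "A \<subseteq> central_layer G p L"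
        have Lsub: "subgroup L G" using L by (rule normal_imp_subgroup)
        have "d \<in> L" unfolding d_def using AL wpA g central_layerD(3) by blast
        then have "(w [^] p) [^] i \<otimes> k \<in> L" using k(2) by simp
        then have "(w [^] p) [^] i \<in> L"
          using mem_subgroup_cancel_right[OF Lsub _ subsetD[OF KL k(1)]] wc by simp
        then have wpL: "w [^] p \<in> L"
          using mem_subgroup_if_coprime_power[OF Lsub prime_p _ subsetD[OF KL wppK] _ False] wc by simp
        show "A \<subseteq> L"
        proof
          fix a assume "a \<in> A"
          then obtain i :: nat and k where "k \<in> K" "a = (w [^] p) [^] i \<otimes> k"
            using form unfolding A_def by blast
          then show "a \<in> L"
            using subgroup.m_closed[OF Lsub subgroup_pow_closed[OF Lsub wpL]] KL by blast
        qed
      qed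
      then show ?thesis using \<open>d \<in> A\<close> unfolding d_def by blast
    qed
  qed
  have C: "subgroup (central_layer G 0 K) G"
    using central_layer_normal(1)[OF KN] by (rule normal_imp_subgroup)
  have "w [^] p \<in> central_layer G 0 K" using pow_comm wc by (simp add: central_layer_def)
  then have AC: "a \<in> central_layer G 0 K" if "a \<in> A" for a
    using form[of a] that subgroup.m_closed[OF C subgroup_pow_closed[OF C]]
      central_layer_normal(2)[OF KN, of 0] unfolding A_def by blast
  show "power_span G p S \<subseteq> central_layer G p K"
  proof
    fix a assume "a \<in> power_span G p S"
    then have a: "a \<in> A" by (simp add: A_def)
    then have "a [^] p \<in> K" using power_span_mem[OF a] AAK by blast
    then show "a \<in> central_layer G p K"
      using central_layerD(1,3)[OF AC[OF a]] by (simp add: central_layer_def)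
  qed
  show "K \<subseteq> power_span G p S" unfolding K_def by (rule power_span_mono[OF F(2)])
qed

text \<open>
The coset of \<open>x\<close> generates \<open>G/N\<close>, and its powers lie in \<open>M\<close>, so the remaining factor does as well.
\<close>

lemma maximal_intersection_form:
  assumes M: "maximal_subgroup M G" and N: "maximal_subgroup N G"
    and x: "x \<in> M" "x \<notin> N" and s: "s \<in> M"
  shows "\<exists>i::nat. \<exists>f \<in> M \<inter> N. s = x [^] i \<otimes> f"
proof -
  have Ms: "subgroup M G" by (rule maximal_subgroup_imp_subgroup[OF M])
  have c: "x \<in> carrier G" "s \<in> carrier G" using subgroup.mem_carrier[OF Ms] x s by auto
  obtain i :: nat and n where n: "n \<in> N" "s = x [^] i \<otimes> n"
    using maximal_normal_coset_powers[OF finite_carrier N maximal_normal[OF N] c(1) x(2) c(2)] by metis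
  have "n \<in> M"
    using mem_subgroup_cancel_left[OF Ms _ subgroup_pow_closed[OF Ms x(1)], of n i] n s
      subgroup.mem_carrier[OF maximal_subgroup_imp_subgroup[OF N] n(1)] by simp
  then show ?thesis using n by blast
qed

text \<open>
The quotient \<open>G/(M \<inter> N)\<close> is elementary abelian of rank 2 with basis the cosets of \<open>x\<close> and \<open>y\<close>, and \<open>R\<close> is the
preimage of the line spanned by \<open>xy\<close>. A maximal subgroup above this preimage cannot be larger, as otherwise
it would contain \<open>x\<close> and hence \<open>y\<close>.
\<close>

lemma third_maximal_subgroup:
  assumes M: "maximal_subgroup M G" and N: "maximal_subgroup N G"
    and x: "x \<in> M" "x \<notin> N" and y: "y \<in> N" "y \<notin> M"
    and sep: "\<And>R. maximal_subgroup R G \<Longrightarrow> x \<in> R \<Longrightarrow> y \<in> R \<Longrightarrow> False"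
  obtains R where "maximal_subgroup R G" "M \<inter> N \<subseteq> R" "x \<otimes> y \<in> R"
    "\<And>r. r \<in> R \<Longrightarrow> \<exists>i::nat. \<exists>f \<in> M \<inter> N. r = (x \<otimes> y) [^] i \<otimes> f"
proof -
  interpret M: normal M G by (rule maximal_normal[OF M])
  interpret N: normal N G by (rule maximal_normal[OF N])
  define F where "F = M \<inter> N"
  have FN: "F \<lhd> G" unfolding F_def by (rule normal_subgroup_intersect[OF M.normal_axioms N.normal_axioms])
  interpret F: normal F G by (fact FN)
  have xc: "x \<in> carrier G" and yc: "y \<in> carrier G" using x y by auto
  have xyc: "x \<otimes> y \<in> carrier G" using xc yc by simp
  have pF: "g [^] p \<in> F" if "g \<in> carrier G" for g
    using pow_mem_maximal[OF M that] pow_mem_maximal[OF N that] by (simp add: F_def)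
  have xyM: "x \<otimes> y \<notin> M" using mem_subgroup_cancel_left[OF M.is_subgroup yc x(1)] y(2) by blast
  from quotient_map[OF FN] obtain Q :: "'a set monoid" and q where
    hom: "group_hom G Q q" and surj: "q ` carrier G = carrier Q"
    and q: "\<And>a. a \<in> carrier G \<Longrightarrow> q a = \<one>\<^bsub>Q\<^esub> \<longleftrightarrow> a \<in> F" by metis
  interpret q: group_hom G Q q by (fact hom)
  have finQ: "finite (carrier Q)" using finite_imageI[OF finite_carrier, of q] surj by simp
  \<comment> \<open>the preimage of the line spanned by \<open>xy\<close>; it omits \<open>x\<close>, since \<open>x\<close> and \<open>y\<close> are independent modulo \<open>F\<close>\<close>
  define T where "T = {g \<in> carrier G. q g \<in> generate Q {q (x \<otimes> y)}}"
  have T: "subgroup T G" unfolding T_def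
    using xyc by (intro q.subgroup_preimage q.H.generate_is_subgroup) auto
  have FT: "F \<subseteq> T"
  proof
    fix f assume f: "f \<in> F"
    then have "q f = \<one>\<^bsub>Q\<^esub>" using q by simp
    then show "f \<in> T" using f generate.one[of Q] by (simp add: T_def)
  qed
  have xyT: "x \<otimes> y \<in> T" using xyc unfolding T_def by (blast intro: generate.incl)
  have qxyc: "q (x \<otimes> y) \<in> carrier Q" using xyc by (rule q.hom_closed)
  have "x \<notin> T"
  proof
    assume "x \<in> T"
    then obtain i :: nat where i: "q x = q (x \<otimes> y) [^]\<^bsub>Q\<^esub> i"
      using q.H.generate_pow_on_finite_carrier[OF finQ qxyc] unfolding T_def by blast
    define e where "e = (x \<otimes> y) [^] i"
    have ec: "e \<in> carrier G" using xyc by (simp add: e_def)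
    have "q e = q x" using i xyc unfolding e_def by (simp only: q.hom_nat_pow)
    then have "q (inv e \<otimes> x) = \<one>\<^bsub>Q\<^esub>" using ec xc by simp
    then have f: "inv e \<otimes> x \<in> F" using q[of "inv e \<otimes> x"] ec xc by (metis inv_closed m_closed)
    have xe: "x = e \<otimes> (inv e \<otimes> x)" using ec xc by (simp add: inv_mult_cancel)
    have "e \<in> M" using mem_subgroup_cancel_right[OF M.is_subgroup ec, of "inv e \<otimes> x"] f xe x(1)
      unfolding F_def by auto
    then have "p dvd i"
      using mem_subgroup_if_coprime_power[OF M.is_subgroup prime_p xyc pow_mem_maximal[OF M xyc]] xyM
      unfolding e_def by blast
    then have "e \<in> F" unfolding e_def by (rule pow_dvd_mem[OF F.is_subgroup xyc pF[OF xyc]])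
    then have "e \<otimes> (inv e \<otimes> x) \<in> F" using f by (rule F.m_closed)
    then show False using x(2) xe by (simp add: F_def)
  qed
  then obtain R where R: "maximal_subgroup R G" "T \<subseteq> R"
    using exists_maximal_subgroup[OF finite_carrier T] xc by metis
  interpret R: subgroup R G by (rule maximal_subgroup_imp_subgroup[OF R(1)])
  have xyR: "x \<otimes> y \<in> R" using xyT R(2) by blast
  have xR: "x \<notin> R"
    using sep[OF R(1)] mem_subgroup_cancel_left[OF R.is_subgroup yc _ xyR] by blast
  have form: "\<exists>i::nat. \<exists>f \<in> F. r = (x \<otimes> y) [^] i \<otimes> f" if r: "r \<in> R" for r
  proof -
    have rc: "r \<in> carrier G" using r by simp
    obtain i :: nat and m where m: "m \<in> M" "r = (x \<otimes> y) [^] i \<otimes> m"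
      using maximal_normal_coset_powers[OF finite_carrier M maximal_normal[OF M] xyc xyM rc] by metis
    have mR: "m \<in> R"
      using mem_subgroup_cancel_left[OF R.is_subgroup _ subgroup_pow_closed[OF R.is_subgroup xyR], of m i] r m
      by simp
    obtain j :: nat and f where f: "f \<in> F" "m = x [^] j \<otimes> f"
      using maximal_intersection_form[OF M N x m(1)] unfolding F_def by blast
    have "f \<in> R" using f(1) FT R(2) by blast
    then have "x [^] j \<in> R"
      using mem_subgroup_cancel_right[OF R.is_subgroup, of "x [^] j" f] f mR xc by simp
    then have "p dvd j"
      using mem_subgroup_if_coprime_power[OF R.is_subgroup prime_p xc pow_mem_maximal[OF R(1) xc]] xR by blast
    then have "x [^] j \<in> F" by (rule pow_dvd_mem[OF F.is_subgroup xc pF[OF xc]])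
    then have "m \<in> F" using f F.m_closed by simp
    then show ?thesis using m by blast
  qed
  show ?thesis
    using that[OF R(1) _ xyR] FT R(2) form unfolding F_def by blast
qed

text \<open>
If \<open>x\<close> and \<open>y\<close> share a maximal subgroup, that subgroup being powerful settles the claim. Otherwise \<open>(xy)\<^sup>p\<close> is
expanded modulo \<open>K\<close> and \<open>x\<^sup>p y\<^sup>p\<close> is located in \<open>R\<^sup>p\<close> or \<open>M\<^sup>p\<close>, both of which consist of \<open>p\<close>-th powers.
\<close>

lemma p_pow_mult_closed:
  assumes cover: "\<And>x. x \<in> carrier G \<Longrightarrow> \<exists>M. maximal_subgroup M G \<and> x \<in> M"
    and x: "x \<in> carrier G" and y: "y \<in> carrier G"
  shows "\<exists>z \<in> carrier G. x [^] p \<otimes> y [^] p = z [^] p"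
proof -
  have root: "\<exists>z \<in> carrier G. x [^] p \<otimes> y [^] p = z [^] p"
    if S: "maximal_subgroup S G" and mem: "x [^] p \<otimes> y [^] p \<in> power_span G p S" for S
    using maximal_facts(1)[OF S mem] subgroup.mem_carrier[OF maximal_subgroup_imp_subgroup[OF S]] by blast
  show ?thesis
  proof (cases "\<exists>S. maximal_subgroup S G \<and> x \<in> S \<and> y \<in> S")
    case True
    then obtain S where S: "maximal_subgroup S G" "x \<in> S" "y \<in> S" by blast
    have "subgroup (power_span G p S) G"
      by (intro power_span_subgroup subgroup.subset maximal_subgroup_imp_subgroup S)
    then have "x [^] p \<otimes> y [^] p \<in> power_span G p S"
      by (rule subgroup.m_closed) (intro power_span_mem S)+
    then show ?thesis by (rule root[OF S(1)])
  next
    case False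
    obtain M N where M: "maximal_subgroup M G" and xM: "x \<in> M"
      and N: "maximal_subgroup N G" and yN: "y \<in> N" using cover x y by metis
    have xN: "x \<notin> N" and yM: "y \<notin> M" using False M N xM yN by blast+
    obtain R where R: "maximal_subgroup R G" and FR: "M \<inter> N \<subseteq> R" and xyR: "x \<otimes> y \<in> R"
      and genR: "\<And>r. r \<in> R \<Longrightarrow> \<exists>i::nat. \<exists>f \<in> M \<inter> N. r = (x \<otimes> y) [^] i \<otimes> f"
      using third_maximal_subgroup[OF M N xM xN yN yM] False by blast
    define F K where "F = M \<inter> N" and "K = power_span G p F"
    have FN: "F \<lhd> G" unfolding F_def
      using maximal_normal[OF M] maximal_normal[OF N] by (rule normal_subgroup_intersect)
    have pF: "\<forall>g \<in> carrier G. g [^] p \<in> F"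
      using pow_mem_maximal[OF M] pow_mem_maximal[OF N] by (simp add: F_def)
    have KN: "K \<lhd> G" unfolding K_def by (rule power_span_normal[OF FN])
    interpret K: normal K G by (fact KN)
    have FM: "F \<subseteq> M" and FN': "F \<subseteq> N" and FR': "F \<subseteq> R" using FR by (auto simp: F_def)
    have genM: "\<forall>s \<in> M. \<exists>i::nat. \<exists>f \<in> F. s = x [^] i \<otimes> f"
      unfolding F_def using maximal_intersection_form[OF M N xM xN] by blast
    have genN: "\<forall>s \<in> N. \<exists>i::nat. \<exists>f \<in> F. s = y [^] i \<otimes> f"
      unfolding F_def Int_commute[of M N] using maximal_intersection_form[OF N M yN yM] by blast
    have genR': "\<forall>s \<in> R. \<exists>i::nat. \<exists>f \<in> F. s = (x \<otimes> y) [^] i \<otimes> f"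
      unfolding F_def using genR by blast
    note extM = maximal_cyclic_extension[OF M FN FM xM pF genM, folded K_def]
    note extN = maximal_cyclic_extension[OF N FN FN' yN pF genN, folded K_def]
    note extR = maximal_cyclic_extension[OF R FN FR' xyR pF genR', folded K_def]
    define c u v where "c = commutator G y x" and "u = commutator G c x" and "v = commutator G c y"
    have cF: "c \<in> F" unfolding F_def c_def
      using commutator_mem_maximal[OF M y x] commutator_mem_maximal[OF N y x] by blast
    have cc: "c \<in> carrier G" and uc: "u \<in> carrier G" and vc: "v \<in> carrier G"
      using x y by (simp_all add: c_def u_def v_def)
    have uM: "u \<in> power_span G p M" unfolding u_def
      using cF FM xM by (intro maximal_facts(2)[OF M]) auto
    have vN: "v \<in> power_span G p N" unfolding v_def
      using cF FN' yN by (intro maximal_facts(2)[OF N]) auto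
    have u: "u \<in> central_layer G p K" and v: "v \<in> central_layer G p K"
      using uM vN extM(2) extN(2) by blast+
    have cp: "c [^] p \<in> K" unfolding K_def by (rule power_span_mem[OF cF])
    obtain k where k: "k \<in> K"
      "(x \<otimes> y) [^] p = x [^] p \<otimes> y [^] p \<otimes> u [^] (p choose 3) \<otimes> v [^] (2 * (p choose 3)) \<otimes> k"
      using pow_mult_mod[OF KN prime_p odd_p x y c_def cp u_def u v_def v] by blast
    have kc: "k \<in> carrier G" using k(1) by simp
    have spanR: "subgroup (power_span G p R) G"
      by (intro power_span_subgroup subgroup.subset maximal_subgroup_imp_subgroup R)
    have xypR: "(x \<otimes> y) [^] p \<in> power_span G p R" by (rule power_span_mem[OF xyR])
    show ?thesis
    proof (cases "p = 3")
      case False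
      have "p dvd (p choose 3)"
      proof -
        have "p \<noteq> 2" using odd_p by auto
        then have "3 < p" using False prime_ge_2_nat[OF prime_p] by linarith
        then show ?thesis using prime_p by (intro dvd_choose_prime) auto
      qed
      then have "u [^] (p choose 3) \<in> K" "v [^] (2 * (p choose 3)) \<in> K"
        using pow_dvd_mem[OF K.is_subgroup uc central_layerD(2)[OF u]]
          pow_dvd_mem[OF K.is_subgroup vc central_layerD(2)[OF v]] by simp_all
      then have "u [^] (p choose 3) \<otimes> (v [^] (2 * (p choose 3)) \<otimes> k) \<in> K"
        using k(1) by (intro K.m_closed)
      moreover have "(x [^] p \<otimes> y [^] p) \<otimes> (u [^] (p choose 3) \<otimes> (v [^] (2 * (p choose 3)) \<otimes> k))
          \<in> power_span G p R"
        using xypR k(2) x y uc vc kc by (simp add: m_assoc)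
      ultimately have "x [^] p \<otimes> y [^] p \<in> power_span G p R"
        using mem_subgroup_cancel_right[OF spanR, of "x [^] p \<otimes> y [^] p"] extR(3) x y by blast
      then show ?thesis by (rule root[OF R])
    next
      case True
      from quotient_map[OF KN] obtain Q :: "'a set monoid" and q where
        hom: "group_hom G Q q" and q: "\<And>a. a \<in> carrier G \<Longrightarrow> q a = \<one>\<^bsub>Q\<^esub> \<longleftrightarrow> a \<in> K" by metis
      interpret q: group_hom G Q q by (fact hom)
      have qK: "q a = \<one>\<^bsub>Q\<^esub>" if "a \<in> K" for a using q that by simp
      have pull_back: "a \<in> S" if S: "subgroup S G" "K \<subseteq> S" and a: "a \<in> carrier G" "q a \<in> q ` S" for S a
      proof -
        obtain s where s: "s \<in> S" "q a = q s" using a(2) by blast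
        have sc: "s \<in> carrier G" by (rule subgroup.mem_carrier[OF S(1) s(1)])
        have "q (inv s \<otimes> a) = \<one>\<^bsub>Q\<^esub>" using s(2) sc a(1) by simp
        then have "inv s \<otimes> a \<in> S" using q[of "inv s \<otimes> a"] sc a(1) S(2) by blast
        then show ?thesis
          using mem_subgroup_cancel_left[OF S(1) a(1) subgroup.m_inv_closed[OF S(1) s(1)]] by blast
      qed
      define xp yp where "xp = x [^] p" and "yp = y [^] p"
      have Xc: "xp \<in> carrier G" and Yc: "yp \<in> carrier G" using x y by (simp_all add: xp_def yp_def)
      have XM: "xp \<in> power_span G p M" and YN: "yp \<in> power_span G p N"
        unfolding xp_def yp_def by (intro power_span_mem xM yN)+
      have xp: "xp \<in> central_layer G p K" and yp: "yp \<in> central_layer G p K"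
        using XM YN extM(2) extN(2) by blast+
      obtain i :: nat and ku where ku: "ku \<in> K" "u = xp [^] i \<otimes> ku"
        using extM(1)[OF uM] unfolding xp_def by blast
      obtain j :: nat and kv where kv: "kv \<in> K" "v = yp [^] j \<otimes> kv"
        using extN(1)[OF vN] unfolding yp_def by blast
      have qu: "q u = q xp [^]\<^bsub>Q\<^esub> i" unfolding ku(2)
        using Xc K.mem_carrier[OF ku(1)] qK[OF ku(1)] by (simp add: q.hom_nat_pow)
      have qv: "q v = q yp [^]\<^bsub>Q\<^esub> j" unfolding kv(2)
        using Yc K.mem_carrier[OF kv(1)] qK[OF kv(1)] by (simp add: q.hom_nat_pow)
      define W where "W = q xp \<otimes>\<^bsub>Q\<^esub> q yp \<otimes>\<^bsub>Q\<^esub> q xp [^]\<^bsub>Q\<^esub> i \<otimes>\<^bsub>Q\<^esub> (q yp [^]\<^bsub>Q\<^esub> j) [^]\<^bsub>Q\<^esub> (2::nat)"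
      have qxy: "q ((x \<otimes> y) [^] p) = W"
      proof -
        have "(x \<otimes> y) [^] p = xp \<otimes> yp \<otimes> u \<otimes> v [^] (2::nat) \<otimes> k"
          using k(2) uc True by (simp add: xp_def yp_def)
        then show ?thesis
          using Xc Yc uc vc kc by (simp add: W_def q.hom_nat_pow qK[OF k(1)] qu qv)
      qed
      \<comment> \<open>\<open>R\<close> is powerful and contains \<open>c\<close> and \<open>xy\<close>; modulo \<open>K\<close> the commutator \<open>[c, xy]\<close> is \<open>vu\<close>\<close>
      have "commutator G c (x \<otimes> y) \<in> power_span G p R"
        using cF FR' xyR by (intro maximal_facts(2)[OF R]) auto
      then have "v \<otimes> u \<otimes> commutator G u y \<in> power_span G p R"
        unfolding commutator_mult_right[OF cc x y] u_def v_def .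
      moreover have "commutator G u y \<in> power_span G p R" using central_layerD(3)[OF u y] extR(3) by blast
      ultimately have vu: "v \<otimes> u \<in> power_span G p R"
        using mem_subgroup_cancel_right[OF spanR m_closed[OF vc uc]] by blast
      have "q xp \<otimes>\<^bsub>Q\<^esub> q yp \<in> q ` power_span G p R \<or> q xp = q yp"
      proof (rule q.H.exponent_three_mem_or_eq)
        show "q xp [^]\<^bsub>Q\<^esub> (3::nat) = \<one>\<^bsub>Q\<^esub>" "q yp [^]\<^bsub>Q\<^esub> (3::nat) = \<one>\<^bsub>Q\<^esub>"
          using qK[OF central_layerD(2)[OF xp]] qK[OF central_layerD(2)[OF yp]] Xc Yc True
          by (simp_all add: q.hom_nat_pow)
        have "q (commutator G xp yp) = \<one>\<^bsub>Q\<^esub>" using qK[OF central_layerD(3)[OF xp Yc]] .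
        then show "q xp \<otimes>\<^bsub>Q\<^esub> q yp = q yp \<otimes>\<^bsub>Q\<^esub> q xp"
          using Xc Yc by (simp add: q.hom_commutator q.H.commutator_eq_one_iff)
        show "subgroup (q ` power_span G p R) Q" by (rule q.subgroup_img_is_subgroup[OF spanR])
        show "q xp \<otimes>\<^bsub>Q\<^esub> q yp \<otimes>\<^bsub>Q\<^esub> q xp [^]\<^bsub>Q\<^esub> i \<otimes>\<^bsub>Q\<^esub> (q yp [^]\<^bsub>Q\<^esub> j) [^]\<^bsub>Q\<^esub> (2::nat) \<in> q ` power_span G p R"
          using imageI[OF xypR, of q] unfolding qxy W_def .
        show "q yp [^]\<^bsub>Q\<^esub> j \<otimes>\<^bsub>Q\<^esub> q xp [^]\<^bsub>Q\<^esub> i \<in> q ` power_span G p R"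
          using imageI[OF vu, of q] uc vc by (simp add: qu qv)
        assume "q xp \<otimes>\<^bsub>Q\<^esub> q yp \<otimes>\<^bsub>Q\<^esub> q xp [^]\<^bsub>Q\<^esub> i \<otimes>\<^bsub>Q\<^esub> (q yp [^]\<^bsub>Q\<^esub> j) [^]\<^bsub>Q\<^esub> (2::nat) = \<one>\<^bsub>Q\<^esub>"
        then have "q ((x \<otimes> y) [^] p) = \<one>\<^bsub>Q\<^esub>" unfolding qxy W_def .
        then have wK: "(x \<otimes> y) [^] p \<in> K" using q x y by simp
        \<comment> \<open>\<open>R\<^sup>p\<close> is generated modulo \<open>K\<close> by \<open>(xy)\<^sup>p\<close>, which is trivial in this case\<close>
        have "power_span G p R \<subseteq> K"
        proof
          fix a assume "a \<in> power_span G p R"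
          then obtain i :: nat and k where "k \<in> K" "a = ((x \<otimes> y) [^] p) [^] i \<otimes> k"
            using extR(1) by blast
          then show "a \<in> K" using K.m_closed[OF subgroup_pow_closed[OF K.is_subgroup wK]] by blast
        qed
        then show "q ` power_span G p R \<subseteq> {\<one>\<^bsub>Q\<^esub>}" using qK by blast
      qed (use Xc Yc in auto)
      then show ?thesis
      proof
        assume "q xp \<otimes>\<^bsub>Q\<^esub> q yp \<in> q ` power_span G p R"
        then have "q (xp \<otimes> yp) \<in> q ` power_span G p R" using Xc Yc by simp
        then have "xp \<otimes> yp \<in> power_span G p R" using pull_back[OF spanR extR(3)] Xc Yc by simp
        then show ?thesis using root[OF R] unfolding xp_def yp_def by blast
      next
        assume eq: "q xp = q yp"
        have spanM: "subgroup (power_span G p M) G"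
          by (intro power_span_subgroup subgroup.subset maximal_subgroup_imp_subgroup M)
        have "yp \<in> power_span G p M"
          using pull_back[OF spanM extM(3) Yc] imageI[OF XM, of q] unfolding eq by blast
        then have "xp \<otimes> yp \<in> power_span G p M" by (rule subgroup.m_closed[OF spanM XM])
        then show ?thesis using root[OF M] unfolding xp_def yp_def by blast
      qed
    qed
  qed
qed

text \<open>
If \<open>G\<close> is not powerful, it is not abelian and so not cyclic. Then every element lies in a maximal subgroup,
\<open>G\<^sup>p\<close> is powerful, and its elements are \<open>p\<close>-th powers.
\<close>

lemma pow_mult_closed:
  assumes x: "x \<in> carrier G" and y: "y \<in> carrier G"
  shows "\<exists>z \<in> carrier G. x [^] (p ^ i) \<otimes> y [^] (p ^ i) = z [^] (p ^ i)"
proof (cases "powerful p G")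
  case True
  then show ?thesis using powerful_pow_mult_closed[OF _ odd_p x y] by blast
next
  case False
  then obtain a b where ab: "a \<in> carrier G" "b \<in> carrier G"
    "commutator G a b \<notin> power_span G p (carrier G)"
    using p_group powerful_iff_commutators by blast
  have sub: "subgroup (power_span G p (carrier G)) G" by (rule power_span_subgroup) simp
  have nc: "a \<otimes> b \<noteq> b \<otimes> a"
    using ab commutator_eq_one_iff[OF ab(1,2)] subgroup.one_closed[OF sub] by auto
  have cover: "\<exists>M. maximal_subgroup M G \<and> g \<in> M" if g: "g \<in> carrier G" for g
  proof -
    have H: "subgroup (generate G {g}) G" using g by (intro generate_is_subgroup) simp
    have "generate G {g} \<noteq> carrier G"
    proof
      assume "generate G {g} = carrier G"
      then obtain m n :: int where "a = g [^] m" "b = g [^] n"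
        using ab(1,2) generate_pow[OF g] by blast
      then show False using nc g by (simp add: add.commute flip: int_pow_mult)
    qed
    then obtain S where "maximal_subgroup S G" "generate G {g} \<subseteq> S"
      by (rule exists_maximal_subgroup[OF finite_carrier H])
    moreover have "g \<in> generate G {g}" by (simp add: generate.incl)
    ultimately show ?thesis by blast
  qed
  show ?thesis
  proof (cases i)
    case 0
    then show ?thesis using x y by (auto intro!: bexI[of _ "x \<otimes> y"])
  next
    case (Suc j)
    define S where "S = power_span G p (carrier G)"
    have "\<exists>z \<in> S. v [^] (p ^ j) \<otimes> w [^] (p ^ j) = z [^] (p ^ j)" if "v \<in> S" "w \<in> S" for v w
      using powerful_pow_mult_closed[OF power_span_powerful[OF cover] odd_p, of v w j] that
      by (simp add: S_def flip: nat_pow_consistent)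
    moreover have "\<exists>z \<in> carrier G. g = z [^] p" if "g \<in> S" for g
      using that power_span_eq_if_pow_mult_closed[OF p_pow_mult_closed[OF cover]]
      unfolding S_def by blast
    ultimately show ?thesis
      unfolding Suc S_def by (intro pow_mult_closed_step x y) blast+
  qed
qed

end

theorem theorem4p11:
  fixes p :: nat and G :: "('a, 'b) monoid_scheme"
  assumes "Factorial_Ring.prime p" and "odd p"
    and "M1_p_group p G"
  shows "\<forall>i::nat. i \<ge> 1 \<longrightarrow>
    agemo p i G = {g [^]\<^bsub>G\<^esub> (p ^ i) | g. g \<in> carrier G}"
proof -
  interpret m1_group G p
    using assms by (simp add: m1_group_def m1_group_axioms_def M1_p_group_def finite_p_group_def)
  show ?thesis
    using power_span_eq_if_pow_mult_closed[OF pow_mult_closed] by (simp add: agemo_eq_power_span)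
qed

end
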